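(* Assume $d\ge 3$. There exists an algorithm such that, for any distribution $\mu$ on $\mathbb R^d$ with density $p_\mu(x)\propto e^{-f_\mu(x)}$, where $f_\mu\in C^1(\mathbb R^d)$, $\nabla f_\mu(0)=0$, $\nabla f_\mu$ is $L$-Lipschitz and $\mathbb E_{X\sim\mu}\|X\|^2\le M$, and for any $\varepsilon\in(0,1)$, the algorithm outputs a sample $x$ whose distribution $\tilde\mu$ satisfies $\mathrm{TV}(\mu,\tilde\mu)\le\varepsilon$, using at most $\left(\frac{LM}{d\varepsilon}\right)^{O(d)}\cdot \mathrm{poly}(\varepsilon^{-1},d,L,M)$ queries to $f_\mu$ and $\nabla f_\mu$.
   Context: The algorithm has query access to the values $f_\mu(x)$ and gradients $\nabla f_\mu(x)$ at points $x$ of its choice. $\mathrm{TV}$ denotes total variation distance. *)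

theory Defs
  imports "HOL-Probability.Probability"
begin

text \<open>
  The dimension has to be a number that is quantified inside the statement, because the constants
  hidden in the query bound must not depend on it. So \<open>\<real>\<^sup>d\<close> is the space of the product measure on
  the index set \<open>{..<d}\<close>, that is, the functions \<open>nat \<Rightarrow> real\<close> that are extensional on \<open>{..<d}\<close>.
\<close>

type_synonym point = "nat \<Rightarrow> real"

definition lebesgue_Rd :: "nat \<Rightarrow> point measure" where
  "lebesgue_Rd d = (\<Pi>\<^sub>M i\<in>{..<d}. (lborel :: real measure))"

abbreviation Rd :: "nat \<Rightarrow> point set" where
  "Rd d \<equiv> {..<d} \<rightarrow>\<^sub>E (UNIV :: real set)"

definition origin :: "nat \<Rightarrow> point" where
  "origin d = (\<lambda>i\<in>{..<d}. 0)"

definition nrm :: "nat \<Rightarrow> point \<Rightarrow> real" where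
  "nrm d x = L2_set x {..<d}"

definition vdiff :: "nat \<Rightarrow> point \<Rightarrow> point \<Rightarrow> point" where
  "vdiff d x y = (\<lambda>i\<in>{..<d}. x i - y i)"

text \<open>
  \<open>f\<close> is of class \<open>C\<^sup>1\<close> on \<open>\<real>\<^sup>d\<close> and \<open>g\<close> is its gradient: all partial derivatives exist everywhere, are
  the components of \<open>g\<close>, and are jointly continuous. The topology \<^term>\<open>powertop_real {..<d}\<close> is the
  usual one of \<open>\<real>\<^sup>d\<close>.
\<close>

definition C1_with_gradient :: "nat \<Rightarrow> (point \<Rightarrow> real) \<Rightarrow> (point \<Rightarrow> point) \<Rightarrow> bool" where
  "C1_with_gradient d f g \<longleftrightarrow>
     (\<forall>x\<in>Rd d. \<forall>i<d. ((\<lambda>t. f (x(i := t))) has_real_derivative g x i) (at (x i))) \<and>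
     continuous_map (powertop_real {..<d}) (powertop_real {..<d}) g"

definition lipschitz_Rd :: "nat \<Rightarrow> real \<Rightarrow> (point \<Rightarrow> point) \<Rightarrow> bool" where
  "lipschitz_Rd d L g \<longleftrightarrow>
     (\<forall>x\<in>Rd d. \<forall>y\<in>Rd d. nrm d (vdiff d (g x) (g y)) \<le> L * nrm d (vdiff d x y))"

definition has_density_prop_exp_neg :: "nat \<Rightarrow> point measure \<Rightarrow> (point \<Rightarrow> real) \<Rightarrow> bool" where
  "has_density_prop_exp_neg d \<mu> f \<longleftrightarrow>
     (\<exists>c>0. \<mu> = density (lebesgue_Rd d) (\<lambda>x. ennreal (c * exp (- f x))))"

text \<open>Meant for two probability measures on the same measurable space.\<close>

definition TV :: "'a measure \<Rightarrow> 'a measure \<Rightarrow> real" where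
  "TV \<mu> \<nu> = (SUP A\<in>sets \<mu>. \<bar>measure \<mu> A - measure \<nu> A\<bar>)"

text \<open>
  A deterministic adaptive query algorithm is a decision tree: it either stops with an output or
  queries a point and continues depending on the answer, which consists of the value and the
  gradient there. A randomized algorithm is a function from random seeds to such trees; the seed is
  an infinite sequence of independent random reals, uniform on \<open>[0,1]\<close>.
\<close>

datatype query_tree =
    Output point
  | Query point "real \<times> point \<Rightarrow> query_tree"

primrec result :: "(point \<Rightarrow> real \<times> point) \<Rightarrow> query_tree \<Rightarrow> point" where
  "result oracl (Output y) = y"
| "result oracl (Query x k) = result oracl (k (oracl x))"

primrec queries :: "(point \<Rightarrow> real \<times> point) \<Rightarrow> query_tree \<Rightarrow> point list" where
  "queries oracl (Output y) = []"
| "queries oracl (Query x k) = x # queries oracl (k (oracl x))"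

definition random_seed :: "(nat \<Rightarrow> real) measure" where
  "random_seed = (\<Pi>\<^sub>M i\<in>UNIV. uniform_measure lborel {0..1})"

end

theory Submission
  imports Defs
begin

text \<open>
  The algorithm is self-normalised importance sampling with a centred Gaussian proposal: draw \<open>N\<close>
  points, query \<open>f\<close> at each, and return one of them with probability proportional to
  \<open>exp (- f) / q\<close>, where \<open>q\<close> is the Gaussian density. If \<open>w\<close> is the density of \<open>\<mu>\<close> with respect to the
  proposal, Jensen's inequality for \<open>1 / x\<close> shows that the output has density at least \<open>N / (N + w)\<close>
  with respect to \<open>\<mu>\<close>, so the total variation error is at most \<open>E[w / (N + w)]\<close> under \<open>\<mu>\<close>.

  Smoothness bounds the density of \<open>\<mu>\<close> at \<open>x\<close> by \<open>(L / 2\<pi>) ^ (d / 2) * exp (- |\<nabla>f x|\<^sup>2 / 2 L)\<close>, which makes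
  \<open>w\<close> at most exponential in \<open>d\<close> on the ball that carries most of the mass of \<open>\<mu>\<close>. That suffices for
  \<open>\<epsilon> < 1 / 2\<close>. For \<open>\<epsilon> \<ge> 1 / 2\<close>, where \<open>L M / (d \<epsilon>)\<close> can be close to \<open>1\<close>, the expectation of \<open>ln w\<close> is bounded
  instead, using \<open>E[\<nabla>f \<sqdot> X] \<ge> d\<close>; the same inequality gives \<open>L M \<ge> d\<close>.
\<close>

section \<open>Reservoir sampling\<close>

lemma prob_space_unit_uniform: "prob_space (uniform_measure lborel {0..1::real})"
  by (rule prob_space_uniform_measure) auto

lemma prob_space_random_seed: "prob_space random_seed"
  unfolding random_seed_def by (intro prob_space_PiM prob_space_unit_uniform)

lemma sets_random_seed: "sets random_seed = sets (\<Pi>\<^sub>M i\<in>UNIV. (borel :: real measure))"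
  unfolding random_seed_def by (rule sets_PiM_cong) auto

lemma space_random_seed [simp]: "space random_seed = UNIV"
  unfolding random_seed_def by (simp add: space_PiM)

lemma measurable_random_seed_component: "(\<lambda>\<omega>. \<omega> i) \<in> borel_measurable random_seed"
  by (simp add: measurable_cong_sets[OF sets_random_seed refl])

lemma measurable_random_seed_shift:
  "(\<lambda>\<omega> i. \<omega> (i + k)) \<in> measurable random_seed random_seed"
  unfolding measurable_cong_sets[OF refl sets_random_seed]
  by (rule measurable_PiM_single') (auto intro: measurable_random_seed_component)

text \<open>The first \<open>m\<close> coordinates, coordinate \<open>m\<close> and the remaining
  tail are independent, and the tail is again a seed. \<open>loc\<close> encodes that
  \<open>X\<close> reads only the first block: \<open>comb_seq m\<close> takes that block from its
  first sequence and everything later from the second.\<close>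

lemma nn_integral_random_seed_split:
  assumes F: "(\<lambda>(x, u, \<omega>). F x u \<omega>) \<in> borel_measurable (E \<Otimes>\<^sub>M borel \<Otimes>\<^sub>M random_seed)"
    and X: "X \<in> measurable random_seed E"
    and loc: "\<And>\<omega> \<omega>'. X (comb_seq m \<omega> \<omega>') = X \<omega>"
  shows "(\<integral>\<^sup>+\<omega>. F (X \<omega>) (\<omega> m) (\<lambda>i. \<omega> (i + Suc m)) \<partial>random_seed) =
    (\<integral>\<^sup>+x. \<integral>\<^sup>+u. \<integral>\<^sup>+\<omega>. F x u \<omega> \<partial>random_seed \<partial>uniform_measure lborel {0..1} \<partial>distr random_seed E X)"
proof -
  let ?U = "uniform_measure lborel {0..1::real}" and ?R = random_seed
  interpret U: prob_space ?U by (rule prob_space_unit_uniform)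
  interpret S: sequence_space ?U
    by (intro sequence_space.intro product_prob_space.intro product_prob_space_axioms.intro
        product_sigma_finite.intro U.sigma_finite_measure_axioms U.prob_space_axioms)
  have SR: "S.S = ?R" by (simp add: random_seed_def)
  interpret R: prob_space ?R by (rule prob_space_random_seed)
  note [measurable] = X
  have setsU: "sets ?U = sets borel" by simp
  have Fc [measurable (raw)]: "(\<lambda>p. F (a p) (b p) (c p)) \<in> borel_measurable N"
    if "a \<in> measurable N E" "b \<in> borel_measurable N" "c \<in> measurable N ?R" for a b c and N :: "'b measure"
    using measurable_compose[OF measurable_Pair[OF that(1) measurable_Pair[OF that(2,3)]] F] by simp
  \<comment> \<open>Splits off the head: putting a uniform number in front of a seed by
    \<open>case_nat\<close> gives a seed again.\<close>
  have 1: "(\<integral>\<^sup>+\<omega>. H (\<omega> 0) (\<lambda>i. \<omega> (i + Suc 0)) \<partial>?R) = (\<integral>\<^sup>+u. \<integral>\<^sup>+\<omega>. H u \<omega> \<partial>?R \<partial>?U)"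
    if "(\<lambda>(u, \<omega>). H u \<omega>) \<in> borel_measurable (borel \<Otimes>\<^sub>M ?R)" for H :: "real \<Rightarrow> (nat \<Rightarrow> real) \<Rightarrow> ennreal"
  proof -
    have m: "(\<lambda>(s, \<omega>). case_nat s \<omega>) \<in> measurable (?U \<Otimes>\<^sub>M ?R) ?R"
      unfolding SR[symmetric] by measurable
    have H': "(\<lambda>(u, \<omega>). H u \<omega>) \<in> borel_measurable (?U \<Otimes>\<^sub>M ?R)"
      using that by (subst measurable_cong_sets[OF sets_pair_measure_cong[OF setsU refl] refl])
    have Hm: "(\<lambda>\<omega>. H (\<omega> 0) (\<lambda>i. \<omega> (i + Suc 0))) \<in> borel_measurable ?R"
      using measurable_compose[OF measurable_Pair[OF measurable_random_seed_component measurable_random_seed_shift] that, of 0 "Suc 0"]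
      by simp
    then have Hm': "(\<lambda>\<omega>. H (\<omega> 0) (\<lambda>i. \<omega> (i + Suc 0))) \<in> borel_measurable (distr (?U \<Otimes>\<^sub>M ?R) ?R (\<lambda>(s, \<omega>). case_nat s \<omega>))"
      by (simp only: measurable_distr_eq1)
    have "(\<integral>\<^sup>+\<omega>. H (\<omega> 0) (\<lambda>i. \<omega> (i + Suc 0)) \<partial>?R) =
      (\<integral>\<^sup>+\<omega>. H (\<omega> 0) (\<lambda>i. \<omega> (i + Suc 0)) \<partial>distr (?U \<Otimes>\<^sub>M ?R) ?R (\<lambda>(s, \<omega>). case_nat s \<omega>))"
      by (simp only: S.PiM_iter[unfolded SR])
    also have "\<dots> = (\<integral>\<^sup>+p. (case p of (u, \<omega>) \<Rightarrow> H u \<omega>) \<partial>(?U \<Otimes>\<^sub>M ?R))"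
      unfolding nn_integral_distr[OF m Hm']
      by (rule nn_integral_cong) (simp split: prod.split)
    also have "\<dots> = (\<integral>\<^sup>+u. \<integral>\<^sup>+\<omega>. H u \<omega> \<partial>?R \<partial>?U)"
      using R.nn_integral_fst[OF H'] by simp
    finally show ?thesis .
  qed
  have m: "(\<lambda>(\<omega>, \<omega>'). comb_seq m \<omega> \<omega>') \<in> measurable (?R \<Otimes>\<^sub>M ?R) ?R"
    unfolding SR[symmetric] by measurable
  have c: "comb_seq m \<omega> \<omega>' m = \<omega>' 0" "(\<lambda>i. comb_seq m \<omega> \<omega>' (Suc (i + m))) = (\<lambda>i. \<omega>' (Suc i))"
    for \<omega> \<omega>' :: "nat \<Rightarrow> real"
    using comb_seq_add[of m \<omega> \<omega>' 0] comb_seq_add[of m \<omega> \<omega>' "Suc _"] by auto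
  let ?G = "\<lambda>\<omega>. F (X \<omega>) (\<omega> m) (\<lambda>i. \<omega> (i + Suc m))"
  have Fm: "(\<lambda>\<omega>. F (X \<omega>) (\<omega> m) (\<lambda>i. \<omega> (i + Suc m))) \<in> borel_measurable ?R"
    by (rule Fc[OF X measurable_random_seed_component measurable_random_seed_shift])
  then have Fm': "(\<lambda>\<omega>. F (X \<omega>) (\<omega> m) (\<lambda>i. \<omega> (i + Suc m))) \<in>
      borel_measurable (distr (?R \<Otimes>\<^sub>M ?R) ?R (\<lambda>(\<omega>, \<omega>'). comb_seq m \<omega> \<omega>'))"
    by (simp only: measurable_distr_eq1)
  have "(\<integral>\<^sup>+\<omega>. ?G \<omega> \<partial>?R) = (\<integral>\<^sup>+\<omega>. ?G \<omega> \<partial>distr (?R \<Otimes>\<^sub>M ?R) ?R (\<lambda>(\<omega>, \<omega>'). comb_seq m \<omega> \<omega>'))"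
    by (simp only: S.PiM_comb_seq[unfolded SR])
  also have "\<dots> = (\<integral>\<^sup>+p. F (X (fst p)) (snd p 0) (\<lambda>i. snd p (i + Suc 0)) \<partial>(?R \<Otimes>\<^sub>M ?R))"
    unfolding nn_integral_distr[OF m Fm']
    by (rule nn_integral_cong) (simp only: split_beta' loc c add_Suc_right add_0_right)
  also have "\<dots> = (\<integral>\<^sup>+\<omega>. \<integral>\<^sup>+\<omega>'. F (X \<omega>) (\<omega>' 0) (\<lambda>i. \<omega>' (i + Suc 0)) \<partial>?R \<partial>?R)"
  proof -
    have "(\<lambda>p. F (X (fst p)) (snd p 0) (\<lambda>i. snd p (i + Suc 0))) \<in> borel_measurable (?R \<Otimes>\<^sub>M ?R)"
      by (intro Fc measurable_compose[OF measurable_fst X] measurable_compose[OF measurable_snd]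
          measurable_random_seed_component measurable_random_seed_shift)
    from R.nn_integral_fst[OF this] show ?thesis by simp
  qed
  also have "\<dots> = (\<integral>\<^sup>+\<omega>. \<integral>\<^sup>+u. \<integral>\<^sup>+\<omega>'. F (X \<omega>) u \<omega>' \<partial>?R \<partial>?U \<partial>?R)"
  proof (intro nn_integral_cong 1)
    fix \<omega> assume "\<omega> \<in> space ?R"
    then have "X \<omega> \<in> space E" using X by (rule measurable_space[rotated])
    then show "(\<lambda>(u, \<omega>'). F (X \<omega>) u \<omega>') \<in> borel_measurable (borel \<Otimes>\<^sub>M ?R)"
      unfolding split_beta' by (intro Fc measurable_const measurable_fst measurable_snd)
  qed
  also have "\<dots> = (\<integral>\<^sup>+x. \<integral>\<^sup>+u. \<integral>\<^sup>+\<omega>. F x u \<omega> \<partial>?R \<partial>?U \<partial>distr ?R E X)"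
  proof -
    have "(\<lambda>p. F (fst (fst p)) (snd (fst p)) (snd p)) \<in> borel_measurable ((E \<Otimes>\<^sub>M ?U) \<Otimes>\<^sub>M ?R)"
      by (intro Fc) (simp_all cong: measurable_cong_sets)
    then have "(\<lambda>p. \<integral>\<^sup>+\<omega>. F (fst p) (snd p) \<omega> \<partial>?R) \<in> borel_measurable (E \<Otimes>\<^sub>M ?U)"
      using R.borel_measurable_nn_integral_fst by fastforce
    then have "(\<lambda>x. \<integral>\<^sup>+u. \<integral>\<^sup>+\<omega>. F x u \<omega> \<partial>?R \<partial>?U) \<in> borel_measurable E"
      using U.borel_measurable_nn_integral_fst by fastforce
    then show ?thesis
      by (simp only: nn_integral_distr[OF X] measurable_distr_eq1)
  qed
  finally show ?thesis .
qed

text \<open>The convex function c / (a + v) lies above its tangent at v = z. The negative terms of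
  the tangent are moved to the right so that the inequality can be integrated in
  \<open>ennreal\<close>.\<close>

lemma inverse_tangent:
  fixes a v z c :: real
  assumes "0 < a" "0 < v" "0 < z" "0 \<le> c"
  shows "2 * c / (a + z) \<le> c / (a + v) + (c * a / (a + z)\<^sup>2 + c / (a + z)\<^sup>2 * v)"
proof -
  define p where "p = a + v"
  define q where "q = a + z"
  have pq: "0 < p" "0 < q" using assms by (auto simp: p_def q_def)
  \<comment> \<open>The gap between the function and its tangent is exactly this square
    term.\<close>
  have "0 \<le> c * ((p - q)\<^sup>2 / (p * q\<^sup>2))"
    using assms pq by auto
  also have "(p - q)\<^sup>2 / (p * q\<^sup>2) = 1 / p + p / q\<^sup>2 - 2 / q"
    using pq by (simp add: field_simps power2_eq_square)
  also have "c * \<dots> = c / p + c * p / q\<^sup>2 - 2 * c / q"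
    by (simp add: algebra_simps)
  also have "c * p / q\<^sup>2 = c * a / q\<^sup>2 + c / q\<^sup>2 * v"
    by (simp add: p_def distrib_left add_divide_distrib)
  finally show ?thesis by (simp add: p_def q_def)
qed

text \<open>The switch accepts with probability v / (S + v). For \<open>S = 0\<close> the threshold
  is 1, so the first candidate is accepted almost surely.\<close>

lemma nn_integral_uniform_switch:
  fixes p q :: ennreal
  assumes "0 < v" "0 \<le> S"
  shows "(\<integral>\<^sup>+u. (if u * (S + v) \<le> v then p else q) \<partial>uniform_measure lborel {0..1}) =
    ennreal (v / (S + v)) * p + ennreal (S / (S + v)) * q"
proof -
  let ?t = "v / (S + v)"
  have t: "0 \<le> ?t" "?t \<le> 1" "1 - ?t = S / (S + v)" using assms by (auto simp: field_simps)
  have iff: "u * (S + v) \<le> v \<longleftrightarrow> u \<le> ?t" for u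
    using assms by (simp add: pos_le_divide_eq)
  have "(\<integral>\<^sup>+u. (if u * (S + v) \<le> v then p else q) \<partial>uniform_measure lborel {0..1}) =
    (\<integral>\<^sup>+u. (if u * (S + v) \<le> v then p else q) * indicator {0..1} u \<partial>lborel)"
    by (subst nn_integral_uniform_measure) (auto simp: divide_ennreal_def)
  also have "\<dots> = (\<integral>\<^sup>+u. p * indicator {0..?t} u + q * indicator {?t<..1} u \<partial>lborel)"
    using t iff by (intro nn_integral_cong) (auto simp: indicator_def not_le dest: order.trans less_le_trans)
  also have "\<dots> = p * ennreal ?t + q * ennreal (1 - ?t)"
    using t by (simp add: nn_integral_add nn_integral_cmult)
  finally show ?thesis
    by (simp add: t mult.commute)
qed

text \<open>
  Weighted reservoir sampling. Each round consumes the next \<open>Suc m\<close> coordinates of the seed: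
  \<open>X\<close> reads the first \<open>m\<close> of them to draw a candidate, and coordinate \<open>m\<close> decides whether the candidate,
  whose weight is \<open>V (X \<omega>)\<close>, replaces the current point. The argument \<open>S\<close> of \<open>pick\<close> is the total
  weight seen so far. The algorithm never uses the mean weight \<open>z\<close>, which is the unknown normalisation.
\<close>

locale reservoir =
  fixes E :: "'a measure" and X :: "(nat \<Rightarrow> real) \<Rightarrow> 'a" and m :: nat and V :: "'a \<Rightarrow> real" and z :: real
  assumes X [measurable]: "X \<in> measurable random_seed E"
    and X_local: "\<And>\<omega> \<omega>'. X (comb_seq m \<omega> \<omega>') = X \<omega>"
    and V [measurable]: "V \<in> borel_measurable E"
    and V_pos: "\<And>x. x \<in> space E \<Longrightarrow> 0 < V x"
    and z_pos: "0 < z"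
    and mean_V: "(\<integral>\<^sup>+x. V x \<partial>distr random_seed E X) = ennreal z"
begin

primrec pick :: "nat \<Rightarrow> 'a \<Rightarrow> real \<Rightarrow> (nat \<Rightarrow> real) \<Rightarrow> 'a" where
  "pick 0 x S \<omega> = x"
| "pick (Suc n) x S \<omega> =
     pick n (if \<omega> m * (S + V (X \<omega>)) \<le> V (X \<omega>) then X \<omega> else x) (S + V (X \<omega>)) (\<lambda>i. \<omega> (i + Suc m))"

abbreviation "Q \<equiv> distr random_seed E X"

text \<open>The arguments are themselves measurable functions because each round changes the point,
  the total weight and the seed together.\<close>

lemma measurable_pick [measurable (raw)]:
  assumes "a \<in> measurable N E" "b \<in> borel_measurable N" "c \<in> measurable N random_seed"
  shows "(\<lambda>p. pick n (a p) (b p) (c p)) \<in> measurable N E"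
  using assms
proof (induction n arbitrary: a b c)
  case (Suc n)
  note [measurable] = Suc.prems(1,2) measurable_compose[OF Suc.prems(3) X]
    measurable_compose[OF Suc.prems(3) measurable_random_seed_component]
  show ?case
    unfolding pick.simps
    by (rule Suc.IH; (rule measurable_compose[OF Suc.prems(3) measurable_random_seed_shift])?) measurable
qed simp

lemma prob_space_Q: "prob_space Q"
  using prob_space.prob_space_distr[OF prob_space_random_seed X] .

text \<open>Integrates \<open>inverse_tangent\<close>, whose base point \<open>z\<close> is the mean
  of \<open>V\<close>.\<close>

lemma jensen_inverse:
  assumes "0 < a" "0 \<le> c"
  shows "ennreal (c / (a + z)) \<le> (\<integral>\<^sup>+x. ennreal (c / (a + V x)) \<partial>Q)"
proof -
  interpret Q: prob_space Q by (rule prob_space_Q)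
  have "ennreal (2 * c / (a + z)) = (\<integral>\<^sup>+x. ennreal (2 * c / (a + z)) \<partial>Q)"
    using Q.emeasure_space_1 by simp
  also have "\<dots> \<le> (\<integral>\<^sup>+x. ennreal (c / (a + V x)) + (ennreal (c * a / (a + z)\<^sup>2) + ennreal (c / (a + z)\<^sup>2) * ennreal (V x)) \<partial>Q)"
  proof (rule nn_integral_mono)
    fix x assume "x \<in> space Q"
    then have v: "0 < V x" using V_pos by auto
    show "ennreal (2 * c / (a + z)) \<le> ennreal (c / (a + V x)) + (ennreal (c * a / (a + z)\<^sup>2) + ennreal (c / (a + z)\<^sup>2) * ennreal (V x))"
      using assms v z_pos inverse_tangent[of a "V x" z c]
      by (simp add: ennreal_plus[symmetric] ennreal_mult[symmetric] ennreal_leI del: ennreal_plus)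
  qed
  also have "\<dots> = (\<integral>\<^sup>+x. ennreal (c / (a + V x)) \<partial>Q) + (ennreal (c * a / (a + z)\<^sup>2) + ennreal (c / (a + z)\<^sup>2) * ennreal z)"
    using Q.emeasure_space_1 by (simp add: nn_integral_add nn_integral_cmult mean_V)
  also have "ennreal (c * a / (a + z)\<^sup>2) + ennreal (c / (a + z)\<^sup>2) * ennreal z = ennreal (c * a / (a + z)\<^sup>2 + c / (a + z)\<^sup>2 * z)"
    using assms z_pos by (simp flip: ennreal_plus ennreal_mult)
  also have "c * a / (a + z)\<^sup>2 + c / (a + z)\<^sup>2 * z = c * (a + z) / ((a + z) * (a + z))"
    by (simp add: power2_eq_square distrib_left add_divide_distrib)
  also have "\<dots> = c / (a + z)"
    by simp
  \<comment> \<open>At the mean, the terms moved to the right add up to c / (a + z), which cancels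
    one of the two copies on the left.\<close>
  finally have "ennreal (c / (a + z)) + ennreal (c / (a + z)) \<le> ennreal (c / (a + z)) + (\<integral>\<^sup>+x. ennreal (c / (a + V x)) \<partial>Q)"
    using assms z_pos by (subst ennreal_plus[symmetric]) (simp_all add: add.commute)
  then show ?thesis
    by (simp add: ennreal_add_left_cancel_le)
qed

text \<open>
  If one of \<open>n\<close> candidates is chosen with probability proportional to its weight, then conditionally
  on its value \<open>y\<close> the total weight has mean \<open>V y + (n - 1) z\<close>, and the inverse is convex. The additional
  terms for the initial state \<open>(x, S)\<close> make the bound inductive.
\<close>

lemma pick_lower_bound:
  assumes A [measurable]: "A \<in> sets E" and "x \<in> space E" "0 \<le> S"
  shows "ennreal (indicator A x * S / (S + real n * z)) +
      (\<integral>\<^sup>+y. ennreal (real n * (indicator A y * V y / (S + V y + (real n - 1) * z))) \<partial>Q)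
    \<le> (\<integral>\<^sup>+\<omega>. indicator A (pick n x S \<omega>) \<partial>random_seed)"
  using assms(2,3)
proof (induction n arbitrary: x S)
  case 0
  interpret R: prob_space random_seed by (rule prob_space_random_seed)
  have "(\<integral>\<^sup>+\<omega>. indicator A x \<partial>random_seed) = indicator A x"
    using R.emeasure_space_1 by simp
  then show ?case
    \<comment> \<open>For \<open>S = 0\<close> the quotient \<open>S / S\<close> is 0, so a starting
      point without weight claims nothing.\<close>
    by (cases "S = 0"; cases "x \<in> A") simp_all
next
  case (Suc n)
  note [simp] = Suc.prems
  interpret Q: prob_space Q by (rule prob_space_Q)
  let ?U = "uniform_measure lborel {0..1::real}"
  define B where "B T = (\<integral>\<^sup>+y. ennreal (real n * (indicator A y * V y / (T + V y + (real n - 1) * z))) \<partial>Q)" for T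
  have meas [measurable]: "(\<lambda>p. real n * (indicator A (snd p) * V (snd p) / (S + V (fst p) + V (snd p) + (real n - 1) * z)))
      \<in> borel_measurable (Q \<Otimes>\<^sub>M Q)"
    by measurable
  have measB: "(\<lambda>y. B (S + V y)) \<in> borel_measurable Q"
    unfolding B_def using Q.borel_measurable_nn_integral_fst[OF measurable_compose[OF meas measurable_ennreal]] by simp
  have UP: "prob_space ?U" by (rule prob_space_unit_uniform)
  \<comment> \<open>By symmetry of the candidates the factor n + 1 splits into one share for the
    first candidate and n shares for the later ones.\<close>
  have "ennreal (indicator A x * S / (S + real (Suc n) * z)) +
      (\<integral>\<^sup>+y. ennreal (real (Suc n) * (indicator A y * V y / (S + V y + (real (Suc n) - 1) * z))) \<partial>Q)
     = ennreal (indicator A x * S / (S + real n * z + z)) +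
      (\<integral>\<^sup>+y. ennreal (indicator A y * V y / (S + V y + real n * z)) + 
        ennreal (real n * (indicator A y * V y / (S + V y + real n * z))) \<partial>Q)"
    using z_pos by (intro arg_cong2[where f="(+)"] nn_integral_cong)
      (auto simp: indicator_def V_pos less_imp_le distrib_right add_divide_distrib add_ac simp flip: ennreal_plus)
  also have "\<dots> = ennreal (indicator A x * S / (S + real n * z + z)) +
      (\<integral>\<^sup>+y. ennreal (indicator A y * V y / (S + V y + real n * z)) \<partial>Q) +
       (\<integral>\<^sup>+y. ennreal (real n * (indicator A y * V y / (S + V y + real n * z))) \<partial>Q)"
    by (simp add: nn_integral_add add.assoc)
  \<comment> \<open>In the shares of the old point and of the later candidates, one \<open>z\<close>
    stands for the weight of the first candidate; Jensen replaces it by the actual random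
    weight.\<close>
  also have "\<dots> \<le> (\<integral>\<^sup>+y. ennreal (indicator A x * S / (S + V y + real n * z)) \<partial>Q) +
       (\<integral>\<^sup>+y. ennreal (indicator A y * V y / (S + V y + real n * z)) \<partial>Q) +
       (\<integral>\<^sup>+y. B (S + V y) \<partial>Q)"
  proof (intro add_mono order.refl)
    show "ennreal (indicator A x * S / (S + real n * z + z)) \<le> (\<integral>\<^sup>+y. ennreal (indicator A x * S / (S + V y + real n * z)) \<partial>Q)"
    proof (cases "S = 0")
      case False
      then show ?thesis
        using jensen_inverse[of "S + real n * z" "indicator A x * S"] Suc.prems z_pos
        by (simp add: add_ac add_pos_nonneg)
    qed simp
    \<comment> \<open>Here \<open>x\<close> is the first candidate and \<open>y\<close> a later one;
      Fubini then makes the first candidate the outer variable.\<close>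
    have "(\<integral>\<^sup>+y. ennreal (real n * (indicator A y * V y / (S + V y + real n * z))) \<partial>Q) \<le>
      (\<integral>\<^sup>+y. \<integral>\<^sup>+x. ennreal (real n * (indicator A y * V y / (S + V x + V y + (real n - 1) * z))) \<partial>Q \<partial>Q)"
    proof (rule nn_integral_mono)
      fix y assume "y \<in> space Q"
      then have v: "0 < V y" by (simp add: V_pos)
      show "ennreal (real n * (indicator A y * V y / (S + V y + real n * z))) \<le>
        (\<integral>\<^sup>+x. ennreal (real n * (indicator A y * V y / (S + V x + V y + (real n - 1) * z))) \<partial>Q)"
      \<comment> \<open>For \<open>n = 0\<close> the coefficient n - 1 is negative and the
        denominator need not be positive, but the factor n vanishes.\<close>
      proof (cases "n = 0")
        case False
        then have "0 < S + V y + (real n - 1) * z"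
          using v z_pos Suc.prems by (intro add_pos_nonneg add_nonneg_pos) auto
        from jensen_inverse[OF this, of "real n * (indicator A y * V y)"] v show ?thesis
          by (simp add: algebra_simps)
      qed simp
    qed
    also have "\<dots> = (\<integral>\<^sup>+y. B (S + V y) \<partial>Q)"
    proof -
      interpret P: pair_sigma_finite Q Q ..
      show ?thesis
        unfolding B_def using P.Fubini[OF measurable_compose[OF meas measurable_ennreal]] by simp
    qed
    finally show "(\<integral>\<^sup>+y. ennreal (real n * (indicator A y * V y / (S + V y + real n * z))) \<partial>Q) \<le> (\<integral>\<^sup>+y. B (S + V y) \<partial>Q)" .
  qed
  also have "\<dots> = (\<integral>\<^sup>+y. ennreal (indicator A x * S / (S + V y + real n * z)) +
       ennreal (indicator A y * V y / (S + V y + real n * z)) + B (S + V y) \<partial>Q)"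
    using measB by (simp add: nn_integral_add)
  also have "\<dots> \<le> (\<integral>\<^sup>+y. \<integral>\<^sup>+u. \<integral>\<^sup>+\<omega>. indicator A
      (pick n (if u * (S + V y) \<le> V y then y else x) (S + V y) \<omega>) \<partial>random_seed \<partial>?U \<partial>Q)"
  proof (rule nn_integral_mono)
    fix y assume "y \<in> space Q"
    then have y: "y \<in> space E" and v: "0 < V y" by (auto simp: V_pos)
    let ?T = "S + V y"
    let ?H = "\<lambda>x. ennreal (indicator A x * ?T / (?T + real n * z))"
    have T: "0 < ?T" by (rule add_nonneg_pos[OF Suc.prems(2) v])
    \<comment> \<open>The switch probabilities have denominator S + V y, which cancels against the
      weight that the survivor carries into the remaining rounds. The sum is thus an average of
      induction hypotheses.\<close>
    have "ennreal (indicator A x * S / (S + V y + real n * z)) +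
       ennreal (indicator A y * V y / (S + V y + real n * z)) =
       ennreal (V y / (S + V y)) * ?H y + ennreal (S / (S + V y)) * ?H x"
      using T v z_pos by (auto simp: indicator_def simp flip: ennreal_mult ennreal_plus)
    also have "\<dots> = (\<integral>\<^sup>+u. (if u * (S + V y) \<le> V y then ?H y else ?H x) \<partial>?U)"
      using v by (subst nn_integral_uniform_switch) auto
    finally have "ennreal (indicator A x * S / (S + V y + real n * z)) +
       ennreal (indicator A y * V y / (S + V y + real n * z)) + B ?T = 
       (\<integral>\<^sup>+u. (if u * (S + V y) \<le> V y then ?H y else ?H x) + B ?T \<partial>?U)"
      using prob_space.emeasure_space_1[OF UP] by (simp add: nn_integral_add)
    also have "\<dots> \<le> (\<integral>\<^sup>+u. \<integral>\<^sup>+\<omega>. indicator A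
      (pick n (if u * (S + V y) \<le> V y then y else x) (S + V y) \<omega>) \<partial>random_seed \<partial>?U)"
      using T y Suc.IH[of _ ?T, folded B_def] by (intro nn_integral_mono) auto
    finally show "ennreal (indicator A x * S / (S + V y + real n * z)) +
       ennreal (indicator A y * V y / (S + V y + real n * z)) + B ?T \<le> \<dots>" .
  qed
  also have "\<dots> = (\<integral>\<^sup>+\<omega>. indicator A (pick (Suc n) x S \<omega>) \<partial>random_seed)"
    unfolding pick.simps
    by (rule nn_integral_random_seed_split[symmetric, where F="\<lambda>y u \<omega>. indicator A (pick n (if u * (S + V y) \<le> V y then y else x) (S + V y) \<omega>)"])
       (measurable, auto simp: X_local)
  finally show ?case .
qed

end

section \<open>Total variation error of reservoir sampling\<close>

text \<open>The bound applied to the complement of an event gives the opposite inequality.\<close>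

lemma TV_le:
  assumes "prob_space \<mu>" "prob_space \<nu>" and sets: "sets \<mu> = sets \<nu>"
    and le: "\<And>A. A \<in> sets \<mu> \<Longrightarrow> measure \<mu> A \<le> measure \<nu> A + \<epsilon>"
  shows "TV \<mu> \<nu> \<le> \<epsilon>"
proof -
  interpret M: prob_space \<mu> by fact
  interpret N: prob_space \<nu> by fact
  have sp: "space \<mu> = space \<nu>" by (rule sets_eq_imp_space_eq[OF sets])
  show ?thesis
    unfolding TV_def
  proof (rule cSUP_least)
    fix A assume A: "A \<in> sets \<mu>"
    then have "measure \<mu> (space \<mu> - A) = 1 - measure \<mu> A" "measure \<nu> (space \<mu> - A) = 1 - measure \<nu> A"
      using M.prob_compl[of A] N.prob_compl[of A] sets sp by auto
    with le[OF A] le[of "space \<mu> - A"] A show "\<bar>measure \<mu> A - measure \<nu> A\<bar> \<le> \<epsilon>"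
      by (auto simp: abs_le_iff)
  qed auto
qed

text \<open>With w = V / z, the output has density at least n w / (n + w) with respect to
  \<open>Q\<close>. This falls short of w by w times w / (n + w), and the factor w turns the
  integral over \<open>Q\<close> into one over \<open>\<mu>\<close>.\<close>

lemma (in reservoir) TV_pick_le:
  assumes \<mu>: "prob_space \<mu>" "\<mu> = density Q (\<lambda>x. ennreal (V x / z))"
    and "x \<in> space E" "0 < n" "0 \<le> \<epsilon>"
    and le: "(\<integral>\<^sup>+y. ennreal (V y / (real n * z + V y)) \<partial>\<mu>) \<le> ennreal \<epsilon>"
  shows "TV \<mu> (distr random_seed E (pick n x 0)) \<le> \<epsilon>"
proof (rule TV_le)
  let ?\<nu> = "distr random_seed E (pick n x 0)"
  have mp: "pick n x 0 \<in> measurable random_seed E"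
    by (rule measurable_pick) (auto simp: assms)
  show P: "prob_space ?\<nu>"
    by (rule prob_space.prob_space_distr[OF prob_space_random_seed mp])
  show "sets \<mu> = sets ?\<nu>" by (simp add: \<mu>)
  interpret N: prob_space ?\<nu> by fact
  interpret M: prob_space \<mu> by fact
  fix A assume A: "A \<in> sets \<mu>"
  then have [measurable]: "A \<in> sets E" by (simp add: \<mu>)
  have "emeasure \<mu> A = (\<integral>\<^sup>+y. ennreal (V y / z) * indicator A y \<partial>Q)"
    by (simp add: \<mu>(2) emeasure_density)
  also have "\<dots> \<le> (\<integral>\<^sup>+y. ennreal (real n * (indicator A y * V y / (0 + V y + (real n - 1) * z))) +
      ennreal (V y / z) * ennreal (V y / (real n * z + V y)) \<partial>Q)"
  proof (rule nn_integral_mono)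
    fix y assume "y \<in> space Q"
    then have v: "0 < V y" by (simp add: V_pos)
    have d: "0 < V y + (real n - 1) * z" "V y + (real n - 1) * z \<le> real n * z + V y"
    proof -
      have "0 \<le> (real n - 1) * z" using z_pos \<open>0 < n\<close> by simp
      with v show "0 < V y + (real n - 1) * z" by simp
      show "V y + (real n - 1) * z \<le> real n * z + V y" using z_pos by (simp add: algebra_simps)
    qed
    have "V y / z = real n * V y / (real n * z + V y) + V y / z * (V y / (real n * z + V y))"
    proof -
      define D where "D = real n * z + V y"
      have "0 < D" using v z_pos by (simp add: D_def add_nonneg_pos)
      then have "V y / z = V y * D / (z * D)" by simp
      also have "V y * D = z * (real n * V y) + V y * V y" by (simp add: D_def algebra_simps)
      also have "\<dots> / (z * D) = real n * V y / D + V y / z * (V y / D)"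
        using z_pos by (simp add: add_divide_distrib)
      finally show ?thesis unfolding D_def .
    qed
    \<comment> \<open>\<open>pick_lower_bound\<close> has n - 1 in the denominator, since the chosen
      candidate's own weight is not averaged; n is slightly weaker and simpler.\<close>
    moreover have "real n * V y / (real n * z + V y) \<le> real n * V y / (V y + (real n - 1) * z)"
      using v d by (intro divide_left_mono) auto
    ultimately have "V y / z \<le> real n * V y / (V y + (real n - 1) * z) + V y / z * (V y / (real n * z + V y))"
      by linarith
    then show "ennreal (V y / z) * indicator A y \<le> ennreal (real n * (indicator A y * V y / (0 + V y + (real n - 1) * z))) +
      ennreal (V y / z) * ennreal (V y / (real n * z + V y))"
      using v z_pos d
      by (auto simp: indicator_def ennreal_leI simp flip: ennreal_mult ennreal_plus)
  qed
  also have "\<dots> = (\<integral>\<^sup>+y. ennreal (real n * (indicator A y * V y / (0 + V y + (real n - 1) * z))) \<partial>Q) +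
      (\<integral>\<^sup>+y. ennreal (V y / (real n * z + V y)) \<partial>\<mu>)"
    unfolding \<mu>(2) by (subst nn_integral_add) (auto simp: nn_integral_density)
  also have "\<dots> \<le> emeasure ?\<nu> A + ennreal \<epsilon>"
  proof (rule add_mono[OF _ le])
    have "(\<integral>\<^sup>+y. ennreal (real n * (indicator A y * V y / (0 + V y + (real n - 1) * z))) \<partial>Q) \<le>
      (\<integral>\<^sup>+\<omega>. indicator A (pick n x 0 \<omega>) \<partial>random_seed)"
      using pick_lower_bound[of A x 0 n] assms by simp
    also have "\<dots> = (\<integral>\<^sup>+y. indicator A y \<partial>?\<nu>)"
      using mp by (simp add: nn_integral_distr del: nn_integral_indicator)
    finally show "(\<integral>\<^sup>+y. ennreal (real n * (indicator A y * V y / (0 + V y + (real n - 1) * z))) \<partial>Q) \<le> emeasure ?\<nu> A"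
      by simp
  qed
  finally show "measure \<mu> A \<le> measure ?\<nu> A + \<epsilon>"
    unfolding M.emeasure_eq_measure N.emeasure_eq_measure using \<open>0 \<le> \<epsilon>\<close>
    by (simp flip: ennreal_plus)
qed (fact \<mu>)

section \<open>Gaussian points from uniform seeds\<close>

definition gauss_density :: "nat \<Rightarrow> real \<Rightarrow> point \<Rightarrow> real" where
  "gauss_density d s x = (\<Prod>i<d. normal_density 0 s (x i))"

lemma space_lebesgue_Rd [simp]: "space (lebesgue_Rd d) = Rd d"
  by (simp add: lebesgue_Rd_def space_PiM)

lemma measurable_lebesgue_Rd_component [measurable]: "i < d \<Longrightarrow> (\<lambda>x. x i) \<in> borel_measurable (lebesgue_Rd d)"
  unfolding lebesgue_Rd_def using measurable_component_singleton[of i "{..<d}" "\<lambda>_. lborel"] by simp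

lemma measurable_gauss_density [measurable]: "gauss_density d s \<in> borel_measurable (lebesgue_Rd d)"
  unfolding gauss_density_def by measurable

lemma product_sigma_finite_lborel: "product_sigma_finite (\<lambda>i::nat. lborel :: real measure)"
  by (simp add: product_sigma_finite_def lborel.sigma_finite_measure_axioms)

lemma nn_integral_lebesgue_Rd_prod:
  assumes "\<And>i. i < d \<Longrightarrow> h i \<in> borel_measurable borel"
  shows "(\<integral>\<^sup>+x. (\<Prod>i<d. h i (x i)) \<partial>lebesgue_Rd d) = (\<Prod>i<d. \<integral>\<^sup>+t. h i t \<partial>lborel)"
  unfolding lebesgue_Rd_def
  by (rule product_sigma_finite.product_nn_integral_prod[OF product_sigma_finite_lborel]) (auto simp: assms)

lemma PiM_normal_density:
  assumes "0 < s"
  shows "(\<Pi>\<^sub>M i\<in>{..<d}. density lborel (normal_density 0 s)) = density (lebesgue_Rd d) (gauss_density d s)"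
proof (rule product_sigma_finite.PiM_eqI[symmetric])
  interpret P: prob_space "density lborel (normal_density 0 s)"
    using assms by (rule prob_space_normal_density)
  show "product_sigma_finite (\<lambda>i::nat. density lborel (normal_density 0 s))"
    by (simp add: product_sigma_finite_def P.sigma_finite_measure_axioms)
  show "sets (density (lebesgue_Rd d) (gauss_density d s)) = sets (\<Pi>\<^sub>M i\<in>{..<d}. density lborel (normal_density 0 s))"
    unfolding lebesgue_Rd_def sets_density by (rule sets_PiM_cong) auto
  fix A :: "nat \<Rightarrow> real set" assume "\<And>i. i \<in> {..<d} \<Longrightarrow> A i \<in> sets (density lborel (normal_density 0 s))"
  then have A: "\<And>i. i < d \<Longrightarrow> A i \<in> sets borel" by simp
  then have PA: "Pi\<^sub>E {..<d} A \<in> sets (lebesgue_Rd d)"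
    unfolding lebesgue_Rd_def by (intro sets_PiM_I_finite) auto
  have "emeasure (density (lebesgue_Rd d) (gauss_density d s)) (Pi\<^sub>E {..<d} A) =
    (\<integral>\<^sup>+x. ennreal (gauss_density d s x) * indicator (Pi\<^sub>E {..<d} A) x \<partial>lebesgue_Rd d)"
    using PA by (simp add: emeasure_density)
  also have "\<dots> = (\<integral>\<^sup>+x. (\<Prod>i<d. ennreal (normal_density 0 s (x i)) * indicator (A i) (x i)) \<partial>lebesgue_Rd d)"
  proof (rule nn_integral_cong)
    fix x assume "x \<in> space (lebesgue_Rd d)"
    then have "indicator (Pi\<^sub>E {..<d} A) x = (\<Prod>i<d. indicator (A i) (x i) :: ennreal)"
      by (auto simp: indicator_def PiE_iff)
    then show "ennreal (gauss_density d s x) * indicator (Pi\<^sub>E {..<d} A) x = (\<Prod>i<d. ennreal (normal_density 0 s (x i)) * indicator (A i) (x i))"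
      by (simp add: gauss_density_def prod.distrib prod_ennreal)
  qed
  also have "\<dots> = (\<Prod>i<d. \<integral>\<^sup>+t. ennreal (normal_density 0 s t) * indicator (A i) t \<partial>lborel)"
    using A by (intro nn_integral_lebesgue_Rd_prod) auto
  also have "\<dots> = (\<Prod>i<d. emeasure (density lborel (normal_density 0 s)) (A i))"
    using A by (intro prod.cong) (auto simp: emeasure_density)
  finally show "emeasure (density (lebesgue_Rd d) (gauss_density d s)) (Pi\<^sub>E {..<d} A) = \<dots>" .
qed simp

text \<open>Inverse transform sampling: \<open>I\<close> is the pseudo-inverse of the distribution
  function on the open unit interval. It is extended by 0, and the two endpoints are null
  sets.\<close>

lemma real_distribution_from_uniform:
  assumes "real_distribution M"
  shows "\<exists>T \<in> borel_measurable borel. distr (uniform_measure lborel {0..1::real}) borel T = M"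
proof -
  interpret cdf_distribution M by (simp add: cdf_distribution_def assms)
  let ?O = "{0<..<1::real}"
  define T where "T = (\<lambda>u. if u \<in> ?O then I u else 0)"
  have T [measurable]: "T \<in> borel_measurable borel"
    unfolding T_def using measurable_CI by (subst measurable_restrict_space_iff[symmetric]) simp_all
  have Tu: "T \<in> measurable (uniform_measure lborel {0..1::real}) borel"
    using T by (subst measurable_cong_sets[of _ borel _ borel]) simp_all
  have "distr (uniform_measure lborel {0..1::real}) borel T = distr (restrict_space lborel ?O) borel I"
  proof (rule measure_eqI)
    fix A assume "A \<in> sets (distr (uniform_measure lborel {0..1::real}) borel T)"
    then have Ab [measurable]: "A \<in> sets borel" by simp
    have TA: "T -` A \<in> sets borel" using measurable_sets[OF T Ab] by simp
    have "emeasure (distr (uniform_measure lborel {0..1::real}) borel T) A = emeasure lborel ({0..1} \<inter> T -` A)"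
      using TA by (simp add: emeasure_distr[OF Tu Ab] emeasure_uniform_measure divide_ennreal_def)
    also have "\<dots> = emeasure lborel (?O \<inter> T -` A)"
      using AE_lborel_singleton[of 0] AE_lborel_singleton[of 1] TA
      by (intro emeasure_eq_AE) (auto elim!: eventually_elim2)
    also have "?O \<inter> T -` A = I -` A \<inter> ?O" by (auto simp: T_def)
    also have "emeasure lborel (I -` A \<inter> ?O) = emeasure (distr (restrict_space lborel ?O) borel I) A"
      by (subst emeasure_distr) (auto simp: space_restrict_space emeasure_restrict_space)
    finally show "emeasure (distr (uniform_measure lborel {0..1::real}) borel T) A = \<dots>" .
  qed simp
  then have "distr (uniform_measure lborel {0..1::real}) borel T = M"
    unfolding distr_I_eq_M .
  with T show ?thesis by blast
qed

text \<open>Any measurable map that sends the uniform law to the centred normal law serves the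
  purpose, so one is fixed by choice.\<close>

definition gaussian_transform :: "real \<Rightarrow> real \<Rightarrow> real" where
  "gaussian_transform s = (SOME T. T \<in> borel_measurable borel \<and>
     distr (uniform_measure lborel {0..1::real}) borel T = density lborel (normal_density 0 s))"

definition gauss_point :: "nat \<Rightarrow> real \<Rightarrow> (nat \<Rightarrow> real) \<Rightarrow> point" where
  "gauss_point d s \<omega> = (\<lambda>i\<in>{..<d}. gaussian_transform s (\<omega> i))"

lemma gauss_point_Rd [simp]: "gauss_point d s \<omega> \<in> Rd d"
  by (simp add: gauss_point_def)

lemma gaussian_transform:
  assumes "0 < s"
  shows "gaussian_transform s \<in> borel_measurable borel"
    "distr (uniform_measure lborel {0..1::real}) borel (gaussian_transform s) = density lborel (normal_density 0 s)"
proof -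
  have "real_distribution (density lborel (normal_density 0 s))"
    unfolding real_distribution_def real_distribution_axioms_def
    using prob_space_normal_density[OF assms] by simp
  from real_distribution_from_uniform[OF this]
  have "\<exists>T. T \<in> borel_measurable borel \<and>
      distr (uniform_measure lborel {0..1::real}) borel T = density lborel (normal_density 0 s)"
    by blast
  from someI_ex[OF this]
  show "gaussian_transform s \<in> borel_measurable borel"
    "distr (uniform_measure lborel {0..1::real}) borel (gaussian_transform s) = density lborel (normal_density 0 s)"
    unfolding gaussian_transform_def by auto
qed

lemma measurable_gauss_point:
  assumes "0 < s"
  shows "gauss_point d s \<in> measurable random_seed (lebesgue_Rd d)"
  unfolding gauss_point_def lebesgue_Rd_def
  using measurable_compose[OF measurable_random_seed_component gaussian_transform(1)[OF assms]]
  by (intro measurable_restrict) simp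

text \<open>The first \<open>d\<close> seed coordinates are independent and uniform, and
  independence survives a coordinatewise transformation.\<close>

lemma distr_gauss_point:
  assumes s: "0 < s"
  shows "distr random_seed (lebesgue_Rd d) (gauss_point d s) = density (lebesgue_Rd d) (gauss_density d s)"
proof -
  let ?U = "uniform_measure lborel {0..1::real}" and ?N = "density lborel (normal_density 0 s)"
  let ?I = "{..<d}"
  interpret U: prob_space ?U by (rule prob_space_unit_uniform)
  interpret N: prob_space ?N using s by (rule prob_space_normal_density)
  interpret PP: product_prob_space "\<lambda>_::nat. ?U" UNIV
    by (intro product_prob_space.intro product_prob_space_axioms.intro
        product_sigma_finite.intro U.sigma_finite_measure_axioms U.prob_space_axioms)
  have q: "gaussian_transform s \<in> measurable ?U ?N" 
    using gaussian_transform(1)[OF s] by (subst measurable_cong_sets[of ?U borel ?N borel]) simp_all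
  have r: "(\<lambda>x. restrict x ?I) \<in> measurable random_seed (PiM ?I (\<lambda>_. ?U))"
    unfolding random_seed_def by (rule measurable_restrict_subset) simp
  have c: "compose ?I (gaussian_transform s) \<in> measurable (PiM ?I (\<lambda>_. ?U)) (PiM ?I (\<lambda>_. ?N))"
    unfolding compose_def using q by (intro measurable_restrict measurable_compose[OF measurable_component_singleton]) auto
  have "PiM ?I (\<lambda>_. ?N) = PiM ?I (\<lambda>_. distr ?U ?N (gaussian_transform s))"
    using gaussian_transform(2)[OF s] by (intro PiM_cong refl) (auto cong: distr_cong)
  also have "\<dots> = distr (PiM ?I (\<lambda>_. ?U)) (PiM ?I (\<lambda>_. ?N)) (compose ?I (gaussian_transform s))"
    using q by (intro distr_PiM_finite_prob_space'[symmetric]) (auto simp: U.prob_space_axioms N.prob_space_axioms)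
  also have "PiM ?I (\<lambda>_. ?U) = distr random_seed (PiM ?I (\<lambda>_. ?U)) (\<lambda>x. restrict x ?I)"
    unfolding random_seed_def by (rule PP.distr_PiM_restrict_finite[symmetric]) auto
  also have "distr \<dots> (PiM ?I (\<lambda>_. ?N)) (compose ?I (gaussian_transform s)) =
     distr random_seed (PiM ?I (\<lambda>_. ?N)) (compose ?I (gaussian_transform s) \<circ> (\<lambda>x. restrict x ?I))"
    by (rule distr_distr[OF c r])
  also have "\<dots> = distr random_seed (lebesgue_Rd d) (gauss_point d s)"
    by (intro distr_cong refl) (auto simp: lebesgue_Rd_def gauss_point_def compose_def intro!: sets_PiM_cong)
  finally show ?thesis unfolding PiM_normal_density[OF s] ..
qed

section \<open>Functions with Lipschitz gradient\<close>

lemma mvt_between: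
  fixes \<phi> \<phi>' :: "real \<Rightarrow> real"
  assumes "\<And>t. (\<phi> has_real_derivative \<phi>' t) (at t)"
  shows "\<exists>\<xi>. \<bar>\<xi> - a\<bar> \<le> \<bar>b - a\<bar> \<and> \<phi> b - \<phi> a = (b - a) * \<phi>' \<xi>"
proof (cases a b rule: linorder_cases)
  case less
  from MVT2[OF this, of \<phi> \<phi>'] assms obtain \<xi> where "a < \<xi>" "\<xi> < b" "\<phi> b - \<phi> a = (b - a) * \<phi>' \<xi>" by auto
  then show ?thesis by (intro exI[of _ \<xi>]) auto
next
  case greater
  from MVT2[OF this, of \<phi> \<phi>'] assms obtain \<xi> where "b < \<xi>" "\<xi> < a" "\<phi> a - \<phi> b = (a - b) * \<phi>' \<xi>" by auto
  then show ?thesis by (intro exI[of _ \<xi>]) (auto simp: algebra_simps)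
qed auto

lemma continuous_on_L2_set_diff:
  "continuous_on UNIV (\<lambda>y :: nat \<Rightarrow> real. L2_set (\<lambda>i. y i - x i) {..<d})"
  unfolding L2_set_def by (intro continuous_intros continuous_on_product_coordinates)

text \<open>\<open>bound\<close> makes \<open>\<phi>\<close> continuous on all sequences, because
  the seminorm on the right depends continuously on finitely many coordinates.\<close>

lemma borel_measurable_lebesgue_Rd:
  fixes \<phi> :: "(nat \<Rightarrow> real) \<Rightarrow> real"
  assumes ext: "\<And>x y. (\<And>i. i < d \<Longrightarrow> x i = y i) \<Longrightarrow> \<phi> x = \<phi> y"
    and bound: "\<And>x y. \<bar>\<phi> y - \<phi> x\<bar> \<le> A x * L2_set (\<lambda>i. y i - x i) {..<d} + B * (L2_set (\<lambda>i. y i - x i) {..<d})\<^sup>2"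
  shows "\<phi> \<in> borel_measurable (lebesgue_Rd d)"
proof -
  have "continuous_on UNIV \<phi>"
    unfolding continuous_on_def
  proof
    fix x :: "nat \<Rightarrow> real"
    let ?N = "\<lambda>y. L2_set (\<lambda>i. y i - x i) {..<d}"
    have "(?N \<longlongrightarrow> ?N x) (at x within UNIV)"
      using continuous_on_L2_set_diff[of x d, unfolded continuous_on_def] by blast
    moreover have "?N x = 0" by (simp add: L2_set_def)
    ultimately have N: "(?N \<longlongrightarrow> 0) (at x)" by simp
    have "((\<lambda>y. A x * ?N y + B * (?N y)\<^sup>2) \<longlongrightarrow> A x * 0 + B * 0\<^sup>2) (at x)"
      by (intro tendsto_intros N)
    then have lim: "((\<lambda>y. A x * ?N y + B * (?N y)\<^sup>2) \<longlongrightarrow> 0) (at x)"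
      by (simp only: mult_zero_right power_zero_numeral add_0_right)
    have "((\<lambda>y. \<phi> y - \<phi> x) \<longlongrightarrow> 0) (at x)"
    proof (rule Lim_null_comparison[OF _ lim])
      show "\<forall>\<^sub>F y in at x. norm (\<phi> y - \<phi> x) \<le> A x * ?N y + B * (?N y)\<^sup>2"
        unfolding real_norm_def by (intro always_eventually allI bound)
    qed
    then show "(\<phi> \<longlongrightarrow> \<phi> x) (at x within UNIV)"
      by (simp add: LIM_zero_iff)
  qed
  then have "\<phi> \<in> borel_measurable borel"
    by (rule borel_measurable_continuous_onI)
  then have \<phi>: "\<phi> \<in> borel_measurable (\<Pi>\<^sub>M i\<in>UNIV. borel)"
    by (subst measurable_cong_sets[OF sets_PiM_equal_borel refl])
  \<comment> \<open>Padding by 0 embeds \<open>Rd d\<close> measurably into all sequences, and by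
    \<open>ext\<close> it does not change the value of \<open>\<phi>\<close>.\<close>
  have "(\<lambda>x. if i < d then x i else 0) \<in> borel_measurable (lebesgue_Rd d)" for i
    by (cases "i < d") simp_all
  then have "(\<lambda>x i. if i < d then x i else 0) \<in> measurable (lebesgue_Rd d) (\<Pi>\<^sub>M i\<in>UNIV. borel)"
    by (intro measurable_PiM_single') auto
  from measurable_compose[OF this \<phi>] have "(\<lambda>x. \<phi> (\<lambda>i. if i < d then x i else 0)) \<in> borel_measurable (lebesgue_Rd d)" .
  moreover have "\<phi> (\<lambda>i. if i < d then x i else 0) = \<phi> x" for x
    by (rule ext) simp
  ultimately show ?thesis by simp
qed

text \<open>
  \<open>f'\<close> and \<open>g'\<close> extend \<open>f\<close> and \<open>g\<close> from the extensional functions to all of \<^typ>\<open>nat \<Rightarrow> real\<close>, so that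
  points can be added and scaled without restricting them each time.
\<close>

locale smooth_Rd =
  fixes d :: nat and L :: real and f :: "point \<Rightarrow> real" and g :: "point \<Rightarrow> point"
  assumes C1: "C1_with_gradient d f g" and Lip: "lipschitz_Rd d L g" and L_nonneg: "0 \<le> L"
begin

abbreviation norm_d :: "point \<Rightarrow> real" where
  "norm_d x \<equiv> L2_set x {..<d}"

definition f' :: "point \<Rightarrow> real" where
  "f' x = f (restrict x {..<d})"

definition g' :: "point \<Rightarrow> point" where
  "g' x = g (restrict x {..<d})"

lemma f'_eq: "x \<in> Rd d \<Longrightarrow> f' x = f x"
  by (simp add: f'_def PiE_restrict)

lemma f'_cong: "(\<And>i. i < d \<Longrightarrow> x i = y i) \<Longrightarrow> f' x = f' y"
  and g'_cong: "(\<And>i. i < d \<Longrightarrow> x i = y i) \<Longrightarrow> g' x = g' y"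
  unfolding f'_def g'_def by (metis lessThan_iff restrict_ext)+

lemma partial_derivative:
  assumes "i < d"
  shows "((\<lambda>t. f' (x(i := t))) has_real_derivative g' (x(i := s)) i) (at s)"
proof -
  let ?y = "restrict (x(i := s)) {..<d}"
  have "?y \<in> Rd d" by simp
  with C1 assms have "((\<lambda>t. f (?y(i := t))) has_real_derivative g ?y i) (at (?y i))"
    unfolding C1_with_gradient_def by blast
  moreover have "?y(i := t) = restrict (x(i := t)) {..<d}" for t
    using assms by auto
  ultimately show ?thesis using assms by (simp add: f'_def g'_def)
qed

lemma gradient_lipschitz: "norm_d (\<lambda>i. g' x i - g' y i) \<le> L * norm_d (\<lambda>i. x i - y i)"
proof -
  have "nrm d (vdiff d (g' x) (g' y)) \<le> L * nrm d (vdiff d (restrict x {..<d}) (restrict y {..<d}))"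
    using Lip unfolding lipschitz_Rd_def g'_def by simp
  then show ?thesis
    by (simp add: nrm_def vdiff_def cong: L2_set_cong_simp)
qed

lemma gradient_component_lipschitz:
  "i < d \<Longrightarrow> \<bar>g' x i - g' y i\<bar> \<le> L * norm_d (\<lambda>i. x i - y i)"
  using gradient_lipschitz[of x y] member_le_L2_set[of "{..<d}" i "\<lambda>i. \<bar>g' x i - g' y i\<bar>"]
  by (simp add: L2_set_def)

text \<open>
  Differentiability along lines is obtained by changing one coordinate at a time, since only partial
  derivatives are given; the constant \<open>d * L\<close> is crude but only has to be finite.
\<close>

lemma first_order_bound:
  "\<bar>f' (\<lambda>i. x i + h i) - f' x - (\<Sum>i<d. g' x i * h i)\<bar> \<le> real d * L * (norm_d h)\<^sup>2"
proof -
  \<comment> \<open>In \<open>y k\<close> the first \<open>k\<close> coordinates have already been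
    moved.\<close>
  define y where "y k = (\<lambda>i. if i < k then x i + h i else x i)" for k
  have abs_h: "\<bar>h k\<bar> \<le> norm_d h" if "k < d" for k
    using that member_le_L2_set[of "{..<d}" k "\<lambda>i. \<bar>h i\<bar>"] by (simp add: L2_set_def)
  have "\<bar>f' (y k) - f' x - (\<Sum>i<k. g' x i * h i)\<bar> \<le> real k * L * (norm_d h)\<^sup>2" if "k \<le> d" for k
    using that
  proof (induction k)
    case 0
    then show ?case by (simp add: y_def)
  next
    case (Suc k)
    then have k: "k < d" by simp
    obtain \<xi> where \<xi>: "\<bar>\<xi> - x k\<bar> \<le> \<bar>(x k + h k) - x k\<bar>"
      "f' ((y k)(k := x k + h k)) - f' ((y k)(k := x k)) = ((x k + h k) - x k) * g' ((y k)(k := \<xi>)) k"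
      using mvt_between[OF partial_derivative[OF k, of "y k"], of "x k" "x k + h k"] by blast
    have y1: "(y k)(k := x k + h k) = y (Suc k)" and y2: "(y k)(k := x k) = y k"
      by (auto simp: y_def fun_eq_iff)
    \<comment> \<open>Every coordinate of the intermediate point differs from \<open>x\<close> by at
      most the corresponding step of \<open>h\<close>.\<close>
    have "norm_d (\<lambda>i. ((y k)(k := \<xi>)) i - x i) \<le> norm_d h"
    proof -
      have "norm_d (\<lambda>i. \<bar>((y k)(k := \<xi>)) i - x i\<bar>) \<le> norm_d (\<lambda>i. \<bar>h i\<bar>)"
        using \<xi>(1) by (intro L2_set_mono) (auto simp: y_def)
      then show ?thesis by (simp add: L2_set_def)
    qed
    then have "\<bar>g' ((y k)(k := \<xi>)) k - g' x k\<bar> \<le> L * norm_d h"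
      using gradient_component_lipschitz[OF k, of "(y k)(k := \<xi>)" x] L_nonneg
      by (meson mult_left_mono order.trans)
    then have "\<bar>h k * (g' ((y k)(k := \<xi>)) k - g' x k)\<bar> \<le> norm_d h * (L * norm_d h)"
      unfolding abs_mult using abs_h[OF k] L_nonneg by (intro mult_mono) auto
    moreover have "f' (y (Suc k)) - f' x - (\<Sum>i<Suc k. g' x i * h i) =
      (f' (y k) - f' x - (\<Sum>i<k. g' x i * h i)) + h k * (g' ((y k)(k := \<xi>)) k - g' x k)"
      using \<xi>(2) unfolding y1 y2 by (simp add: algebra_simps)
    ultimately have "\<bar>f' (y (Suc k)) - f' x - (\<Sum>i<Suc k. g' x i * h i)\<bar> \<le>
      real k * L * (norm_d h)\<^sup>2 + norm_d h * (L * norm_d h)"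
      using Suc.IH k by linarith
    then show ?case by (simp add: algebra_simps power2_eq_square)
  qed
  from this[of d] show ?thesis
    using f'_cong[of "y d" "\<lambda>i. x i + h i"] by (simp add: y_def)
qed

text \<open>\<open>first_order_bound\<close> for the step \<open>s * h\<close> has an error of order
  s^2, so the difference quotient is off by O(s).\<close>

lemma line_derivative:
  "((\<lambda>t. f' (\<lambda>i. x i + t * h i)) has_real_derivative (\<Sum>i<d. g' (\<lambda>i. x i + t * h i) i * h i)) (at t)"
proof -
  let ?p = "\<lambda>t i. x i + t * h i"
  let ?D = "\<Sum>i<d. g' (?p t) i * h i" and ?C = "real d * L * (norm_d h)\<^sup>2"
  have "((\<lambda>s. (f' (?p (t + s)) - f' (?p t)) / s - ?D) \<longlongrightarrow> 0) (at 0)"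
  proof (rule Lim_null_comparison[of _ "\<lambda>s. ?C * \<bar>s\<bar>"])
    show "\<forall>\<^sub>F s in at 0. norm ((f' (?p (t + s)) - f' (?p t)) / s - ?D) \<le> ?C * \<bar>s\<bar>"
      unfolding eventually_at_filter
    proof (intro always_eventually allI impI)
      fix s :: real assume s: "s \<noteq> 0"
      have "\<bar>f' (\<lambda>i. ?p t i + s * h i) - f' (?p t) - (\<Sum>i<d. g' (?p t) i * (s * h i))\<bar> \<le> real d * L * (norm_d (\<lambda>i. s * h i))\<^sup>2"
        by (rule first_order_bound)
      moreover have "(\<lambda>i. ?p t i + s * h i) = ?p (t + s)" by (simp add: algebra_simps)
      moreover have "(\<Sum>i<d. g' (?p t) i * (s * h i)) = s * ?D" by (simp add: sum_distrib_left algebra_simps)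
      moreover have "norm_d (\<lambda>i. s * h i) = \<bar>s\<bar> * norm_d h"
        by (simp add: L2_set_def power_mult_distrib real_sqrt_mult flip: sum_distrib_left)
      ultimately have *: "\<bar>f' (?p (t + s)) - f' (?p t) - s * ?D\<bar> \<le> ?C * \<bar>s\<bar> * \<bar>s\<bar>"
        by (simp add: power2_eq_square algebra_simps)
      have "(f' (?p (t + s)) - f' (?p t)) / s - ?D = (f' (?p (t + s)) - f' (?p t) - s * ?D) / s"
        using s by (simp add: diff_divide_distrib)
      with * s show "norm ((f' (?p (t + s)) - f' (?p t)) / s - ?D) \<le> ?C * \<bar>s\<bar>"
        by (simp add: pos_divide_le_eq)
    qed
    show "((\<lambda>s. ?C * \<bar>s\<bar>) \<longlongrightarrow> 0) (at 0)" by (rule tendsto_eq_intros | simp)+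
  qed
  then show ?thesis by (simp add: DERIV_def LIM_zero_iff)
qed

text \<open>The auxiliary \<open>?\<psi>\<close> is nonincreasing on [0, 1]: by Cauchy-Schwarz and
  the Lipschitz bound, the directional derivative along \<open>h\<close> grows by at most L t |h|^2
  up to time t.\<close>

lemma descent:
  "f' (\<lambda>i. x i + h i) \<le> f' x + (\<Sum>i<d. g' x i * h i) + L / 2 * (norm_d h)\<^sup>2"
proof -
  let ?p = "\<lambda>t i. x i + t * h i"
  let ?\<psi> = "\<lambda>t. f' (?p t) - t * (\<Sum>i<d. g' x i * h i) - L / 2 * (norm_d h)\<^sup>2 * t\<^sup>2"
  have "?\<psi> 1 \<le> ?\<psi> 0"
  proof (rule DERIV_nonpos_imp_nonincreasing[of 0 1 ?\<psi>])
    fix t :: real assume t: "0 \<le> t" "t \<le> 1"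
    let ?D = "(\<Sum>i<d. g' (?p t) i * h i) - (\<Sum>i<d. g' x i * h i) - L * (norm_d h)\<^sup>2 * t"
    have "(?\<psi> has_real_derivative ?D) (at t)"
      by (auto intro!: derivative_eq_intros line_derivative)
    moreover have "?D \<le> 0"
    proof -
      have "(\<Sum>i<d. g' (?p t) i * h i) - (\<Sum>i<d. g' x i * h i) = (\<Sum>i<d. (g' (?p t) i - g' x i) * h i)"
        by (simp add: sum_subtractf algebra_simps)
      also have "\<dots> \<le> (\<Sum>i<d. \<bar>g' (?p t) i - g' x i\<bar> * \<bar>h i\<bar>)"
        by (intro sum_mono) (metis abs_ge_self abs_mult)
      also have "\<dots> \<le> norm_d (\<lambda>i. g' (?p t) i - g' x i) * norm_d h"
        by (rule L2_set_mult_ineq)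
      also have "\<dots> \<le> L * norm_d (\<lambda>i. ?p t i - x i) * norm_d h"
        by (intro mult_right_mono gradient_lipschitz) auto
      also have "norm_d (\<lambda>i. ?p t i - x i) = t * norm_d h"
        using t by (simp add: L2_set_def power_mult_distrib real_sqrt_mult flip: sum_distrib_left)
      finally show ?thesis by (simp add: power2_eq_square algebra_simps)
    qed
    ultimately show "\<exists>y. (?\<psi> has_real_derivative y) (at t) \<and> y \<le> 0" by blast
  qed simp
  then show ?thesis by simp
qed

lemma measurable_f' [measurable]: "f' \<in> borel_measurable (lebesgue_Rd d)"
proof (rule borel_measurable_lebesgue_Rd)
  fix x y :: point
  let ?h = "\<lambda>i. y i - x i"
  have "\<bar>\<Sum>i<d. g' x i * ?h i\<bar> \<le> (\<Sum>i<d. \<bar>g' x i\<bar> * \<bar>?h i\<bar>)"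
    by (rule order.trans[OF sum_abs]) (simp add: abs_mult)
  also have "\<dots> \<le> norm_d (g' x) * norm_d ?h"
    by (rule L2_set_mult_ineq)
  finally show "\<bar>f' y - f' x\<bar> \<le> norm_d (g' x) * norm_d ?h + real d * L * (norm_d ?h)\<^sup>2"
    using first_order_bound[of x ?h] by simp
qed (rule f'_cong)

lemma measurable_f [measurable]: "f \<in> borel_measurable (lebesgue_Rd d)"
  using measurable_f' by (rule measurable_cong[THEN iffD1, rotated]) (simp add: f'_eq)

lemma measurable_g' [measurable]: "i < d \<Longrightarrow> (\<lambda>x. g' x i) \<in> borel_measurable (lebesgue_Rd d)"
  using gradient_component_lipschitz[of i]
  by (intro borel_measurable_lebesgue_Rd[where A="\<lambda>_. L" and B=0]) (simp_all cong: g'_cong)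

end

section \<open>Smooth densities with bounded second moment\<close>

text \<open>Product measures are determined by boxes, where the scaling factorises over the
  coordinates.\<close>

lemma nn_integral_lebesgue_Rd_scale:
  fixes h :: "point \<Rightarrow> ennreal"
  assumes "0 < a" and h: "h \<in> borel_measurable (lebesgue_Rd d)"
  shows "(\<integral>\<^sup>+x. h x \<partial>lebesgue_Rd d) = ennreal (a ^ d) * (\<integral>\<^sup>+x. h (\<lambda>i\<in>{..<d}. a * x i) \<partial>lebesgue_Rd d)"
proof -
  let ?T = "\<lambda>x. \<lambda>i\<in>{..<d}. a * x i" and ?R = "lebesgue_Rd d"
  have T [measurable]: "?T \<in> measurable ?R ?R"
    unfolding lebesgue_Rd_def
    by (rule measurable_restrict) (simp flip: lebesgue_Rd_def)
  have "density (distr ?R ?R ?T) (\<lambda>_. ennreal (a ^ d)) = ?R"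
    unfolding lebesgue_Rd_def
  proof (rule product_sigma_finite.PiM_eqI[OF product_sigma_finite_lborel], unfold lebesgue_Rd_def[symmetric])
    fix A :: "nat \<Rightarrow> real set" assume "\<And>i. i \<in> {..<d} \<Longrightarrow> A i \<in> sets lborel"
    then have A: "\<And>i. i < d \<Longrightarrow> A i \<in> sets borel" by simp
    have PA: "Pi\<^sub>E {..<d} A \<in> sets ?R"
      unfolding lebesgue_Rd_def using A by (intro sets_PiM_I_finite) auto
    have m: "(\<lambda>t. a * t) -` A i \<in> sets borel" if "i < d" for i
      using measurable_sets[of "\<lambda>t. a * t" borel borel, OF _ A[OF that]] by simp
    have "emeasure (density (distr ?R ?R ?T) (\<lambda>_. ennreal (a ^ d))) (Pi\<^sub>E {..<d} A) =
      ennreal (a ^ d) * emeasure ?R (?T -` Pi\<^sub>E {..<d} A \<inter> space ?R)"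
      using PA by (simp add: emeasure_density_const emeasure_distr)
    also have "?T -` Pi\<^sub>E {..<d} A \<inter> space ?R = Pi\<^sub>E {..<d} (\<lambda>i. (\<lambda>t. a * t) -` A i)"
      by (auto simp: PiE_iff)
    also have "emeasure ?R \<dots> = (\<Prod>i<d. emeasure lborel ((\<lambda>t. a * t) -` A i))"
      unfolding lebesgue_Rd_def using m
      by (intro product_sigma_finite.emeasure_PiM[OF product_sigma_finite_lborel]) auto
    also have "ennreal (a ^ d) * \<dots> = (\<Prod>i<d. ennreal a * emeasure lborel ((\<lambda>t. a * t) -` A i))"
      using \<open>0 < a\<close> by (simp add: prod.distrib ennreal_power)
    also have "\<dots> = (\<Prod>i<d. emeasure lborel (A i))"
    proof (rule prod.cong)
      fix i assume "i \<in> {..<d}"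
      then have [measurable]: "A i \<in> sets borel" using A by simp
      have "emeasure lborel (A i) = (\<integral>\<^sup>+t. indicator (A i) t \<partial>lborel)" by simp
      also have "\<dots> = ennreal a * (\<integral>\<^sup>+t. indicator (A i) (0 + a * t) \<partial>lborel)"
        using \<open>0 < a\<close> by (subst nn_integral_real_affine[of _ a 0]) auto
      also have "(\<lambda>t. indicator (A i) (0 + a * t) :: ennreal) = indicator ((\<lambda>t. a * t) -` A i)"
        by (auto simp: indicator_def)
      also have "(\<integral>\<^sup>+t. indicator ((\<lambda>t. a * t) -` A i) t \<partial>lborel) = emeasure lborel ((\<lambda>t. a * t) -` A i)"
        using m \<open>i \<in> {..<d}\<close> by (intro nn_integral_indicator) simp
      finally show "ennreal a * emeasure lborel ((\<lambda>t. a * t) -` A i) = emeasure lborel (A i)" ..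
    qed simp
    finally show "emeasure (density (distr ?R ?R ?T) (\<lambda>_. ennreal (a ^ d))) (Pi\<^sub>E {..<d} A) = \<dots>" .
  qed simp_all
  then have "(\<integral>\<^sup>+x. h x \<partial>?R) = (\<integral>\<^sup>+x. h x \<partial>density (distr ?R ?R ?T) (\<lambda>_. ennreal (a ^ d)))"
    by simp
  also have "\<dots> = ennreal (a ^ d) * (\<integral>\<^sup>+x. h (?T x) \<partial>?R)"
    using h T by (simp add: nn_integral_density nn_integral_cmult nn_integral_distr)
  finally show ?thesis .
qed

lemma nn_integral_normal_density:
  assumes "0 < \<sigma>"
  shows "(\<integral>\<^sup>+t. ennreal (normal_density m \<sigma> t) \<partial>lborel) = 1"
  using assms by (subst nn_integral_eq_integral) auto

text \<open>Completing the square turns the integrand into a multiple of the normal density with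
  mean a - b / L and variance 1 / L.\<close>

lemma nn_integral_exp_quadratic:
  fixes L :: real
  assumes "0 < L"
  shows "(\<integral>\<^sup>+t. ennreal (exp (- (b * (t - a) + L / 2 * (t - a)\<^sup>2))) \<partial>lborel) =
    ennreal (sqrt (2 * pi / L) * exp (b\<^sup>2 / (2 * L)))"
proof -
  let ?C = "sqrt (2 * pi / L) * exp (b\<^sup>2 / (2 * L))"
  have "exp (- (b * (t - a) + L / 2 * (t - a)\<^sup>2)) = ?C * normal_density (a - b / L) (1 / sqrt L) t" for t
  proof -
    have "b\<^sup>2 / (2 * L) - (t - (a - b / L))\<^sup>2 * L / 2 = - (b * (t - a) + L / 2 * (t - a)\<^sup>2)"
      using assms by (simp add: field_simps power2_eq_square)
    moreover have "sqrt (2 * pi / L) * (1 / sqrt (2 * pi * (1 / sqrt L)\<^sup>2)) = 1"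
      using assms by (simp add: power_divide real_sqrt_divide)
    moreover have "- (t - (a - b / L))\<^sup>2 / (2 * (1 / sqrt L)\<^sup>2) = - (t - (a - b / L))\<^sup>2 * L / 2"
      using assms by (simp add: power_divide)
    ultimately show ?thesis
      unfolding normal_density_def by (simp add: mult_exp_exp mult_ac)
  qed
  then show ?thesis
    using assms by (simp add: ennreal_mult nn_integral_cmult nn_integral_normal_density)
qed

text \<open>\<open>int\<close> accompanies \<open>second_moment\<close> because the integral of a
  non-integrable function defaults to 0.\<close>

locale smooth_target = smooth_Rd +
  fixes \<mu> :: "point measure" and c M :: real
  assumes prob: "prob_space \<mu>"
    and c_pos: "0 < c"
    and \<mu>_def: "\<mu> = density (lebesgue_Rd d) (\<lambda>x. ennreal (c * exp (- f x)))"
    and grad0: "g (origin d) = origin d"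
    and d_pos: "0 < d"
    and int: "integrable \<mu> (\<lambda>x. (nrm d x)\<^sup>2)"
    and second_moment: "(\<integral>x. (nrm d x)\<^sup>2 \<partial>\<mu>) \<le> M"
begin

sublocale prob_space \<mu> by (rule prob)

abbreviation R where "R \<equiv> lebesgue_Rd d"

definition sqnorm :: "point \<Rightarrow> real" where "sqnorm x = (\<Sum>i<d. (x i)\<^sup>2)"

lemma sqnorm_nonneg [simp]: "0 \<le> sqnorm x" by (simp add: sqnorm_def sum_nonneg)

lemma norm_d_square: "(norm_d x)\<^sup>2 = sqnorm x"
  by (simp add: L2_set_def sqnorm_def sum_nonneg)

lemma measurable_sqnorm [measurable]: "sqnorm \<in> borel_measurable R"
  unfolding sqnorm_def by measurable

lemma measurable_sqnorm_grad [measurable]: "(\<lambda>x. sqnorm (g' x)) \<in> borel_measurable R"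
  unfolding sqnorm_def by measurable

lemma \<mu>_eq: "\<mu> = density R (\<lambda>x. ennreal (c * exp (- f' x)))"
  unfolding \<mu>_def by (rule density_cong) (auto simp: f'_eq)

lemma sets_\<mu> [measurable_cong, simp]: "sets \<mu> = sets R"
  by (simp add: \<mu>_eq)

lemma space_\<mu> [simp]: "space \<mu> = Rd d"
  by (simp add: \<mu>_eq)

lemma prob_Rd [simp]: "prob (Rd d) = 1"
  using prob_space by simp

lemma nn_integral_\<mu>:
  "h \<in> borel_measurable R \<Longrightarrow> (\<integral>\<^sup>+x. h x \<partial>\<mu>) = (\<integral>\<^sup>+x. ennreal (c * exp (- f' x)) * h x \<partial>R)"
  unfolding \<mu>_eq by (rule nn_integral_density) auto

lemma total_mass: "(\<integral>\<^sup>+x. ennreal (c * exp (- f' x)) \<partial>R) = 1"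
  using nn_integral_\<mu>[of "\<lambda>_. 1"] emeasure_space_1 by simp

lemma integrable_sqnorm: "integrable \<mu> sqnorm" and expectation_sqnorm: "(\<integral>x. sqnorm x \<partial>\<mu>) \<le> M"
  using int second_moment by (simp_all add: nrm_def norm_d_square)

text \<open>Compare the gradient with its value at the origin, where it vanishes.\<close>

lemma gradient_bound: "sqnorm (g' x) \<le> L\<^sup>2 * sqnorm x"
proof -
  have "g' (\<lambda>i. 0) = origin d"
    using grad0 by (simp add: g'_def origin_def)
  then have "norm_d (g' x) \<le> L * norm_d x"
    using gradient_lipschitz[of x "\<lambda>i. 0"] by (simp add: origin_def cong: L2_set_cong_simp)
  then have "(norm_d (g' x))\<^sup>2 \<le> (L * norm_d x)\<^sup>2"
    by (intro power_mono) auto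
  then show ?thesis by (simp add: power_mult_distrib norm_d_square)
qed

text \<open>The derivative of f (t x) in t at t = 1.\<close>

definition radial :: "point \<Rightarrow> real" where "radial x = (\<Sum>i<d. g' x i * x i)"

lemma measurable_radial [measurable]: "radial \<in> borel_measurable R"
  unfolding radial_def by measurable

lemma abs_radial: "\<bar>radial x\<bar> \<le> L * sqnorm x"
proof -
  have "\<bar>radial x\<bar> \<le> (\<Sum>i<d. \<bar>g' x i\<bar> * \<bar>x i\<bar>)"
    unfolding radial_def by (rule order.trans[OF sum_abs]) (simp add: abs_mult)
  also have "\<dots> \<le> norm_d (g' x) * norm_d x" by (rule L2_set_mult_ineq)
  also have "\<dots> \<le> L * norm_d x * norm_d x"
  proof (rule mult_right_mono)
    have "(norm_d (g' x))\<^sup>2 \<le> (L * norm_d x)\<^sup>2"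
      using gradient_bound[of x] by (simp add: power_mult_distrib norm_d_square)
    then show "norm_d (g' x) \<le> L * norm_d x"
      by (rule power2_le_imp_le) (simp add: L_nonneg)
  qed simp
  also have "\<dots> = L * sqnorm x" by (simp add: norm_d_square[symmetric] power2_eq_square)
  finally show ?thesis .
qed

lemma integrable_radial: "integrable \<mu> radial"
proof (rule Bochner_Integration.integrable_bound)
  show "integrable \<mu> (\<lambda>x. L * sqnorm x)" using integrable_sqnorm by simp
qed (use abs_radial L_nonneg in \<open>auto simp: abs_mult\<close>)

lemma integrable_sqnorm_grad: "integrable \<mu> (\<lambda>x. sqnorm (g' x))"
proof (rule Bochner_Integration.integrable_bound)
  show "integrable \<mu> (\<lambda>x. L\<^sup>2 * sqnorm x)" using integrable_sqnorm by simp
qed (use gradient_bound in auto)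

text \<open>
  Replaces the integration by parts \<open>E[\<nabla>f \<sqdot> X] = d\<close>. Scaling gives
  \<open>E[exp (f X - f ((1 + \<eta>) X))] = (1 + \<eta>) ^ (- d)\<close>; bound the exponential by its tangent,
  \<open>f ((1 + \<eta>) X) - f X\<close> by smoothness, and let \<open>\<eta>\<close> tend to \<open>0\<close>.
\<close>

lemma expectation_radial_ge: "real d \<le> (\<integral>x. radial x \<partial>\<mu>)"
proof -
  let ?P = "\<integral>x. radial x \<partial>\<mu>" and ?S = "\<integral>x. sqnorm x \<partial>\<mu>"
  have "real d / (1 + real d * \<eta>) \<le> ?P + L / 2 * ?S * \<eta>" if \<eta>: "0 < \<eta>" for \<eta>
  proof -
    \<comment> \<open>By \<open>descent\<close>, \<open>h x\<close> is a lower bound of f x - f ((1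
      + \<eta>) x). Unlike that difference, it has an expectation expressed by those of
      \<open>radial\<close> and \<open>sqnorm\<close>.\<close>
    define h where "h x = - (\<eta> * radial x + L / 2 * \<eta>\<^sup>2 * sqnorm x)" for x
    have h_meas [measurable]: "h \<in> borel_measurable R"
      unfolding h_def by measurable
    have h_le: "h x \<le> f' x - f' (\<lambda>i\<in>{..<d}. (1 + \<eta>) * x i)" for x
    proof -
      have "f' (\<lambda>i\<in>{..<d}. (1 + \<eta>) * x i) = f' (\<lambda>i. x i + \<eta> * x i)"
        by (rule f'_cong) (simp add: algebra_simps)
      moreover have "(norm_d (\<lambda>i. \<eta> * x i))\<^sup>2 = \<eta>\<^sup>2 * sqnorm x"
        by (simp add: norm_d_square sqnorm_def power_mult_distrib sum_distrib_left)
      moreover have "(\<Sum>i<d. g' x i * (\<eta> * x i)) = \<eta> * radial x"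
        by (simp add: radial_def sum_distrib_left algebra_simps)
      ultimately show ?thesis
        using descent[of x "\<lambda>i. \<eta> * x i"] by (simp add: h_def)
    qed
    have pow: "0 < (1 + \<eta>) ^ d" using \<eta> by simp
    have "(\<integral>\<^sup>+x. ennreal (exp (h x)) \<partial>\<mu>) = (\<integral>\<^sup>+x. ennreal (c * exp (- f' x)) * ennreal (exp (h x)) \<partial>R)"
      by (rule nn_integral_\<mu>) measurable
    also have "\<dots> \<le> (\<integral>\<^sup>+x. ennreal (c * exp (- f' (\<lambda>i\<in>{..<d}. (1 + \<eta>) * x i))) \<partial>R)"
    proof (rule nn_integral_mono)
      fix x
      have "exp (- f' x) * exp (h x) \<le> exp (- f' (\<lambda>i\<in>{..<d}. (1 + \<eta>) * x i))"
        using h_le[of x] by (simp add: mult_exp_exp)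
      then show "ennreal (c * exp (- f' x)) * ennreal (exp (h x)) \<le> ennreal (c * exp (- f' (\<lambda>i\<in>{..<d}. (1 + \<eta>) * x i)))"
        using c_pos by (simp add: mult.assoc ennreal_leI flip: ennreal_mult)
    qed
    also have "\<dots> = ennreal (1 / (1 + \<eta>) ^ d)"
    proof -
      let ?I = "\<integral>\<^sup>+x. ennreal (c * exp (- f' (\<lambda>i\<in>{..<d}. (1 + \<eta>) * x i))) \<partial>R"
      have one: "ennreal ((1 + \<eta>) ^ d) * ?I = 1"
        using nn_integral_lebesgue_Rd_scale[of "1 + \<eta>" "\<lambda>x. ennreal (c * exp (- f' x))" d] \<eta> total_mass by simp
      have "ennreal (1 / (1 + \<eta>) ^ d) * ennreal ((1 + \<eta>) ^ d) = 1"
        using pow \<eta> by (subst ennreal_mult[symmetric]) auto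
      then have "?I = ennreal (1 / (1 + \<eta>) ^ d) * ennreal ((1 + \<eta>) ^ d) * ?I"
        by simp
      then show ?thesis
        unfolding mult.assoc one by simp
    qed
    finally have nn: "(\<integral>\<^sup>+x. ennreal (exp (h x)) \<partial>\<mu>) \<le> ennreal (1 / (1 + \<eta>) ^ d)" .
    have int_exp: "integrable \<mu> (\<lambda>x. exp (h x))"
      using nn by (intro integrableI_nonneg) (auto simp: le_less_trans)
    have int_h: "integrable \<mu> h"
      unfolding h_def using integrable_radial integrable_sqnorm by simp
    \<comment> \<open>The tangent bound 1 + t \<le> exp t, then Bernoulli's inequality, make
      everything explicit in \<eta>; a factor \<eta> cancels at the end.\<close>
    have "1 + (\<integral>x. h x \<partial>\<mu>) = (\<integral>x. 1 + h x \<partial>\<mu>)"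
      using int_h by (simp add: prob_space)
    also have "\<dots> \<le> (\<integral>x. exp (h x) \<partial>\<mu>)"
      using int_h int_exp by (intro integral_mono) (auto simp: exp_ge_add_one_self)
    also have "\<dots> \<le> 1 / (1 + \<eta>) ^ d"
      using nn pow by (simp add: nn_integral_eq_integral[OF int_exp])
    also have "\<dots> \<le> 1 / (1 + real d * \<eta>)"
      using Bernoulli_inequality[of \<eta> d] \<eta> by (intro divide_left_mono) (auto intro!: mult_pos_pos add_pos_nonneg)
    finally have "1 - 1 / (1 + real d * \<eta>) \<le> - (\<integral>x. h x \<partial>\<mu>)" by simp
    also have "- (\<integral>x. h x \<partial>\<mu>) = \<eta> * (?P + L / 2 * ?S * \<eta>)"
      unfolding h_def using integrable_radial integrable_sqnorm
      by (simp add: algebra_simps power2_eq_square)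
    also have "1 - 1 / (1 + real d * \<eta>) = \<eta> * (real d / (1 + real d * \<eta>))"
    proof -
      have "1 + real d * \<eta> \<noteq> 0" using \<eta> by (metis add_pos_nonneg less_irrefl mult_nonneg_nonneg of_nat_0_le_iff order_less_imp_le zero_less_one)
      then show ?thesis by (simp add: field_simps)
    qed
    finally show ?thesis using \<eta> by (rule mult_left_le_imp_le)
  qed
  then have "\<forall>\<^sub>F \<eta> in at_right 0. real d / (1 + real d * \<eta>) \<le> ?P + L / 2 * ?S * \<eta>"
    by (auto simp: eventually_at_filter intro!: always_eventually)
  moreover have "((\<lambda>\<eta>. real d / (1 + real d * \<eta>)) \<longlongrightarrow> real d / (1 + real d * 0)) (at_right 0)"
    by (intro tendsto_intros) auto
  moreover have "((\<lambda>\<eta>. ?P + L / 2 * ?S * \<eta>) \<longlongrightarrow> ?P + L / 2 * ?S * 0) (at_right 0)"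
    by (intro tendsto_intros)
  ultimately have "real d / (1 + real d * 0) \<le> ?P + L / 2 * ?S * 0"
    by (intro tendsto_le[OF trivial_limit_at_right_real])
  then show ?thesis by simp
qed

text \<open>Since \<open>radial\<close> is at most L |x|^2, its expectation lies between d and L M.
  Hence the base of the query bound is at least 1.\<close>

lemma condition_number: "real d \<le> L * M"
proof -
  have "real d \<le> (\<integral>x. radial x \<partial>\<mu>)" by (rule expectation_radial_ge)
  also have "\<dots> \<le> (\<integral>x. L * sqnorm x \<partial>\<mu>)"
    using integrable_radial integrable_sqnorm abs_radial by (intro integral_mono) (auto simp: abs_le_iff)
  also have "\<dots> \<le> L * M" using expectation_sqnorm L_nonneg by (simp add: mult_left_mono)
  finally show ?thesis .
qed

lemma L_pos: "0 < L" and M_pos: "0 < M"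
  using condition_number d_pos L_nonneg
  by (auto simp: zero_less_mult_iff dest!: less_le_trans[of 0 "real d" "L * M", rotated])

text \<open>Cauchy-Schwarz for the gradient and the position under \<open>\<mu>\<close>, combined
  with \<open>expectation_radial_ge\<close>. It is carried out as a weighted arithmetic-geometric
  mean inequality, with weights that make the |x|^2 part contribute at most d / 2.\<close>

lemma expectation_sqnorm_grad: "(real d)\<^sup>2 / M \<le> (\<integral>x. sqnorm (g' x) \<partial>\<mu>)"
proof -
  have "radial x \<le> M / (2 * real d) * sqnorm (g' x) + real d / (2 * M) * sqnorm x" for x
    unfolding radial_def sqnorm_def sum_distrib_left sum.distrib[symmetric]
  proof (rule sum_mono)
    fix i
    have "0 \<le> (M * g' x i - real d * x i)\<^sup>2 / (2 * real d * M)"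
      using M_pos by simp
    also have "\<dots> = M / (2 * real d) * (g' x i)\<^sup>2 + real d / (2 * M) * (x i)\<^sup>2 - g' x i * x i"
      using M_pos d_pos by (simp add: field_simps power2_eq_square)
    finally show "g' x i * x i \<le> M / (2 * real d) * (g' x i)\<^sup>2 + real d / (2 * M) * (x i)\<^sup>2" by simp
  qed
  then have "(\<integral>x. radial x \<partial>\<mu>) \<le> (\<integral>x. M / (2 * real d) * sqnorm (g' x) + real d / (2 * M) * sqnorm x \<partial>\<mu>)"
    using integrable_radial integrable_sqnorm integrable_sqnorm_grad by (intro integral_mono) auto
  also have "\<dots> = M / (2 * real d) * (\<integral>x. sqnorm (g' x) \<partial>\<mu>) + real d / (2 * M) * (\<integral>x. sqnorm x \<partial>\<mu>)"
    using integrable_sqnorm integrable_sqnorm_grad by simp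
  also have "real d / (2 * M) * (\<integral>x. sqnorm x \<partial>\<mu>) \<le> real d / (2 * M) * M"
    using M_pos by (intro mult_left_mono expectation_sqnorm) simp
  finally have "real d / 2 \<le> M / (2 * real d) * (\<integral>x. sqnorm (g' x) \<partial>\<mu>)"
    using expectation_radial_ge M_pos by simp
  then show ?thesis
    using M_pos d_pos by (simp add: field_simps power2_eq_square)
qed

text \<open>Integrate the quadratic upper bound of \<open>f\<close> around \<open>x\<close>.\<close>

lemma density_bound:
  "c * exp (- f' x) \<le> (\<Prod>i<d. sqrt (L / (2 * pi)) * exp (- (g' x i)\<^sup>2 / (2 * L)))"
proof -
  \<comment> \<open>\<open>?J\<close> is the integral of exp of minus the quadratic part of the
    upper bound. Total mass 1 then gives c exp (- f x) \<open>?J\<close> \<le> 1.\<close>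
  let ?J = "\<Prod>i<d. sqrt (2 * pi / L) * exp ((g' x i)\<^sup>2 / (2 * L))"
  have J: "0 < ?J" using L_pos by (intro prod_pos) auto
  have "ennreal (c * exp (- f' x) * ?J) =
    ennreal (c * exp (- f' x)) * (\<Prod>i<d. \<integral>\<^sup>+t. ennreal (exp (- (g' x i * (t - x i) + L / 2 * (t - x i)\<^sup>2))) \<partial>lborel)"
    unfolding nn_integral_exp_quadratic[OF L_pos] using L_pos c_pos J
    by (subst prod_ennreal) (auto simp flip: ennreal_mult)
  also have "(\<Prod>i<d. \<integral>\<^sup>+t. ennreal (exp (- (g' x i * (t - x i) + L / 2 * (t - x i)\<^sup>2))) \<partial>lborel) =
    (\<integral>\<^sup>+y. (\<Prod>i<d. ennreal (exp (- (g' x i * (y i - x i) + L / 2 * (y i - x i)\<^sup>2)))) \<partial>R)"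
    by (rule nn_integral_lebesgue_Rd_prod[symmetric]) simp
  also have "ennreal (c * exp (- f' x)) * \<dots> =
    (\<integral>\<^sup>+y. ennreal (c * exp (- f' x)) * (\<Prod>i<d. ennreal (exp (- (g' x i * (y i - x i) + L / 2 * (y i - x i)\<^sup>2)))) \<partial>R)"
    by (rule nn_integral_cmult[symmetric]) measurable
  also have "\<dots> \<le> (\<integral>\<^sup>+y. ennreal (c * exp (- f' y)) \<partial>R)"
  proof (rule nn_integral_mono)
    fix y :: point
    let ?h = "\<lambda>i. y i - x i"
    have "f' y \<le> f' x + (\<Sum>i<d. g' x i * ?h i) + L / 2 * sqnorm ?h"
      using descent[of x ?h] by (simp add: norm_d_square)
    also have "\<dots> = f' x + (\<Sum>i<d. g' x i * ?h i + L / 2 * (?h i)\<^sup>2)"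
      by (simp add: sqnorm_def sum.distrib sum_distrib_left)
    finally have "exp (- f' x - (\<Sum>i<d. g' x i * ?h i + L / 2 * (?h i)\<^sup>2)) \<le> exp (- f' y)"
      by simp
    moreover have "(\<Prod>i<d. exp (- (g' x i * ?h i + L / 2 * (?h i)\<^sup>2))) = exp (- (\<Sum>i<d. g' x i * ?h i + L / 2 * (?h i)\<^sup>2))"
      by (simp add: exp_sum[symmetric] sum_negf[symmetric])
    ultimately have "exp (- f' x) * (\<Prod>i<d. exp (- (g' x i * ?h i + L / 2 * (?h i)\<^sup>2))) \<le> exp (- f' y)"
      by (simp add: mult_exp_exp)
    then show "ennreal (c * exp (- f' x)) * (\<Prod>i<d. ennreal (exp (- (g' x i * ?h i + L / 2 * (?h i)\<^sup>2)))) \<le> ennreal (c * exp (- f' y))"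
      using c_pos by (simp add: prod_ennreal prod_nonneg mult.assoc ennreal_leI flip: ennreal_mult)
  qed
  also have "\<dots> = 1" by (rule total_mass)
  finally have "c * exp (- f' x) * ?J \<le> 1"
    by (simp add: ennreal_le_1)
  then have "c * exp (- f' x) \<le> 1 / ?J"
    using J by (simp add: pos_le_divide_eq)
  also have "1 / ?J = (\<Prod>i<d. 1 / (sqrt (2 * pi / L) * exp ((g' x i)\<^sup>2 / (2 * L))))"
    by (simp add: prod_dividef)
  also have "\<dots> = (\<Prod>i<d. sqrt (L / (2 * pi)) * exp (- (g' x i)\<^sup>2 / (2 * L)))"
    by (intro prod.cong) (auto simp: exp_minus real_sqrt_divide field_simps)
  finally show ?thesis .
qed

text \<open>The density of \<open>\<mu>\<close> with respect to the Gaussian proposal with standard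
  deviation \<open>s\<close>.\<close>

definition ratio :: "real \<Rightarrow> point \<Rightarrow> real" where
  "ratio s x = c * exp (- f' x) / gauss_density d s x"

lemma gauss_density_pos: "0 < s \<Longrightarrow> 0 < gauss_density d s x"
  unfolding gauss_density_def by (intro prod_pos) (simp add: normal_density_pos)

lemma ratio_pos: "0 < s \<Longrightarrow> 0 < ratio s x"
  using c_pos gauss_density_pos by (simp add: ratio_def)

lemma measurable_ratio [measurable]: "ratio s \<in> borel_measurable R"
  unfolding ratio_def by measurable

text \<open>Divides \<open>density_bound\<close> by the Gaussian density; the factors 2 \<pi> cancel
  in each coordinate.\<close>

lemma ratio_le:
  assumes s: "0 < s"
  shows "ratio s x \<le> (s * sqrt L) ^ d * exp (sqnorm x / (2 * s\<^sup>2) - sqnorm (g' x) / (2 * L))"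
proof -
  have "ratio s x \<le> (\<Prod>i<d. sqrt (L / (2 * pi)) * exp (- (g' x i)\<^sup>2 / (2 * L))) / gauss_density d s x"
    unfolding ratio_def using gauss_density_pos[OF s, of x] by (intro divide_right_mono density_bound) simp
  also have "\<dots> = (\<Prod>i<d. (s * sqrt L) * exp ((x i)\<^sup>2 / (2 * s\<^sup>2) - (g' x i)\<^sup>2 / (2 * L)))"
    unfolding gauss_density_def prod_dividef[symmetric]
  proof (rule prod.cong)
    fix i
    have "exp ((x i)\<^sup>2 / (2 * s\<^sup>2) - (g' x i)\<^sup>2 / (2 * L)) = exp (- (g' x i)\<^sup>2 / (2 * L)) / exp (- (x i)\<^sup>2 / (2 * s\<^sup>2))"
      by (simp add: exp_diff[symmetric])
    moreover have "sqrt (L / (2 * pi)) / (1 / sqrt (2 * pi * s\<^sup>2)) = s * sqrt L"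
      using s by (simp add: real_sqrt_mult real_sqrt_divide)
    ultimately show "sqrt (L / (2 * pi)) * exp (- (g' x i)\<^sup>2 / (2 * L)) / normal_density 0 s (x i) =
      s * sqrt L * exp ((x i)\<^sup>2 / (2 * s\<^sup>2) - (g' x i)\<^sup>2 / (2 * L))"
      unfolding normal_density_def by (simp add: field_simps)
  qed simp
  also have "\<dots> = (s * sqrt L) ^ d * exp (sqnorm x / (2 * s\<^sup>2) - sqnorm (g' x) / (2 * L))"
    by (simp add: prod.distrib exp_sum[symmetric] sqnorm_def sum_subtractf sum_divide_distrib)
  finally show ?thesis .
qed

end

section \<open>Expected error in the two ranges of accuracy\<close>

lemma nn_integral_gauss_density:
  assumes "0 < s"
  shows "(\<integral>\<^sup>+x. ennreal (gauss_density d s x) \<partial>lebesgue_Rd d) = 1"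
proof -
  have "(\<integral>\<^sup>+x. ennreal (gauss_density d s x) \<partial>lebesgue_Rd d) = (\<integral>\<^sup>+x. (\<Prod>i<d. ennreal (normal_density 0 s (x i))) \<partial>lebesgue_Rd d)"
    by (simp add: gauss_density_def prod_ennreal)
  also have "\<dots> = 1"
    using assms by (subst nn_integral_lebesgue_Rd_prod) (auto simp: nn_integral_normal_density)
  finally show ?thesis .
qed

text \<open>Truncation at exp l: smaller \<open>v\<close> contribute at most 1 / 4, and larger ones
  are handled as in Markov's inequality for ln v. Adding 1 / v keeps the last term nonnegative,
  since ln (1 / v) \<le> 1 / v - 1.\<close>

lemma ratio_le_log:
  fixes v \<psi> l N :: real
  assumes "0 < v" "ln v \<le> \<psi>" "0 < l" "4 * exp l \<le> N"
  shows "v / (N + v) \<le> 1 / 4 + (\<psi> + 1 / v) / l"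
proof (cases "v \<le> exp l")
  case True
  have "0 < N" using assms(4) exp_gt_zero[of l] by linarith
  have "ln (1 / v) \<le> 1 / v - 1"
    using assms by (intro ln_le_minus_one) simp
  then have "0 \<le> (\<psi> + 1 / v) / l"
    using assms by (simp add: ln_div)
  moreover have "v / (N + v) \<le> v / N"
    using \<open>0 < N\<close> assms by (intro divide_left_mono) auto
  moreover have "v / N \<le> 1 / 4"
    using True assms \<open>0 < N\<close> by (simp add: field_simps)
  ultimately show ?thesis by linarith
next
  case False
  then have "l \<le> ln v" using assms by (simp add: ln_ge_iff)
  then have "l \<le> \<psi> + 1 / v"
    using assms by (simp add: add_increasing2)
  then have "1 \<le> (\<psi> + 1 / v) / l" using assms by simp
  moreover have "0 < N" using assms(4) exp_gt_zero[of l] by linarith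
  then have "v / (N + v) \<le> 1" using assms by (simp add: divide_le_eq_1)
  ultimately show ?thesis by linarith
qed

context smooth_target
begin

text \<open>The inverse ratio is the density of the proposal with respect to
  \<open>\<mu>\<close>.\<close>

lemma expectation_inverse_ratio:
  assumes "0 < s"
  shows "integrable \<mu> (\<lambda>x. 1 / ratio s x)" "(\<integral>x. 1 / ratio s x \<partial>\<mu>) = 1"
proof -
  have "(\<integral>\<^sup>+x. ennreal (1 / ratio s x) \<partial>\<mu>) = (\<integral>\<^sup>+x. ennreal (c * exp (- f' x)) * ennreal (1 / ratio s x) \<partial>R)"
    by (rule nn_integral_\<mu>) measurable
  also have "\<dots> = (\<integral>\<^sup>+x. ennreal (gauss_density d s x) \<partial>R)"
  proof (rule nn_integral_cong)
    fix x
    have "c * exp (- f' x) * (1 / ratio s x) = gauss_density d s x"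
      using c_pos by (simp add: ratio_def)
    moreover have "ennreal (c * exp (- f' x)) * ennreal (1 / ratio s x) = ennreal (c * exp (- f' x) * (1 / ratio s x))"
      using c_pos ratio_pos[OF assms, of x] by (intro ennreal_mult[symmetric]) auto
    ultimately show "ennreal (c * exp (- f' x)) * ennreal (1 / ratio s x) = ennreal (gauss_density d s x)"
      by (simp only:)
  qed
  finally have nn: "(\<integral>\<^sup>+x. ennreal (1 / ratio s x) \<partial>\<mu>) = ennreal 1"
    using assms by (simp add: nn_integral_gauss_density)
  have pos: "0 \<le> 1 / ratio s x" for x using ratio_pos[OF assms, of x] by simp
  show int: "integrable \<mu> (\<lambda>x. 1 / ratio s x)"
    using nn pos by (intro integrableI_nonneg) auto
  show "(\<integral>x. 1 / ratio s x \<partial>\<mu>) = 1"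
    using nn nn_integral_eq_integral[OF int] pos by (simp add: integral_nonneg)
qed

lemma nn_integral_le_of_integral:
  fixes h r :: "point \<Rightarrow> real"
  assumes "\<And>x. h x \<le> r x" "\<And>x. 0 \<le> h x" "integrable \<mu> r" "(\<integral>x. r x \<partial>\<mu>) \<le> \<epsilon>"
  shows "(\<integral>\<^sup>+x. ennreal (h x) \<partial>\<mu>) \<le> ennreal \<epsilon>"
proof -
  have "(\<integral>\<^sup>+x. ennreal (h x) \<partial>\<mu>) \<le> (\<integral>\<^sup>+x. ennreal (r x) \<partial>\<mu>)"
    using assms by (intro nn_integral_mono ennreal_leI) auto
  also have "\<dots> = ennreal (\<integral>x. r x \<partial>\<mu>)"
    using assms(1,2) by (intro nn_integral_eq_integral assms(3)) (auto intro: order.trans)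
  finally show ?thesis using assms(4) by (meson ennreal_leI order.trans)
qed

text \<open>
  For \<open>\<epsilon> \<ge> 1 / 2\<close> the base \<open>L M / (d \<epsilon>)\<close> may be arbitrarily close to \<open>1\<close>, so no factor \<open>exp (O d)\<close> can be
  afforded. Here the proposal variance is \<open>M / d\<close>, and the gradient term in \<open>ratio_le\<close> bounds the relative
  entropy of \<open>\<mu>\<close> with respect to the proposal by \<open>d * ln K\<close>, where \<open>K = L M / d\<close>.
\<close>

lemma ratio_bound_coarse:
  assumes s: "s = sqrt (M / real d)" and N: "4 * (exp 4 * (L * M / real d) ^ (4 * d)) \<le> N"
  shows "(\<integral>\<^sup>+x. ennreal (ratio s x / (N + ratio s x)) \<partial>\<mu>) \<le> ennreal (1 / 2)"
proof -
  define K where "K = L * M / real d"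
  have K: "1 \<le> K" using condition_number d_pos by (simp add: K_def)
  have s_pos: "0 < s" using M_pos d_pos by (simp add: s)
  have s2: "s\<^sup>2 = M / real d" using M_pos d_pos by (simp add: s)
  \<comment> \<open>Four times 1 + d ln K, the bound shown below for the expectation of
    \<open>\<psi>\<close> + 1 / \<open>ratio s\<close>.\<close>
  define l where "l = 4 + 4 * real d * ln K"
  have l: "0 < l" using K by (simp add: l_def add_pos_nonneg)
  have "exp l = exp 4 * K ^ (4 * d)"
    using K by (simp add: l_def exp_add exp_of_nat_mult[of "4 * d" "ln K", simplified])
  then have Nl: "4 * exp l \<le> N" using N by (simp add: K_def)
  define \<psi> where "\<psi> x = real d / 2 * ln K + real d / (2 * M) * sqnorm x - sqnorm (g' x) / (2 * L)" for x
  have ln_w: "ln (ratio s x) \<le> \<psi> x" for x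
  proof -
    have "s * sqrt L = sqrt K" by (simp add: s K_def mult.commute flip: real_sqrt_mult)
    then have "ratio s x \<le> sqrt K ^ d * exp (sqnorm x / (2 * s\<^sup>2) - sqnorm (g' x) / (2 * L))"
      using ratio_le[OF s_pos, of x] by simp
    then have "ln (ratio s x) \<le> ln (sqrt K ^ d * exp (sqnorm x / (2 * s\<^sup>2) - sqnorm (g' x) / (2 * L)))"
      using ratio_pos[OF s_pos, of x] K by (subst ln_le_cancel_iff) auto
    also have "\<dots> = \<psi> x"
      using K M_pos d_pos by (simp add: ln_mult ln_realpow ln_sqrt \<psi>_def s2 mult_ac)
    finally show ?thesis .
  qed
  show ?thesis
  proof (rule nn_integral_le_of_integral)
    fix x
    show "ratio s x / (N + ratio s x) \<le> 1 / 4 + (\<psi> x + 1 / ratio s x) / l"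
      by (rule ratio_le_log[OF ratio_pos[OF s_pos] ln_w l Nl])
    have "0 < N" using Nl exp_gt_zero[of l] by linarith
    then show "0 \<le> ratio s x / (N + ratio s x)" using ratio_pos[OF s_pos, of x] by simp
  next
    have int_\<psi>: "integrable \<mu> \<psi>"
      unfolding \<psi>_def using integrable_sqnorm integrable_sqnorm_grad by simp
    then show "integrable \<mu> (\<lambda>x. 1 / 4 + (\<psi> x + 1 / ratio s x) / l)"
      using expectation_inverse_ratio[OF s_pos] by simp
    have "(\<integral>x. \<psi> x \<partial>\<mu>) = real d / 2 * ln K + real d / (2 * M) * (\<integral>x. sqnorm x \<partial>\<mu>) - (\<integral>x. sqnorm (g' x) \<partial>\<mu>) / (2 * L)"
      unfolding \<psi>_def using integrable_sqnorm integrable_sqnorm_grad by (simp add: prob_space)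
    \<comment> \<open>The second moment is bounded above and the squared gradient below.\<close>
    also have "\<dots> \<le> real d / 2 * ln K + real d / (2 * M) * M - ((real d)\<^sup>2 / M) / (2 * L)"
      using M_pos L_pos expectation_sqnorm expectation_sqnorm_grad
      by (intro add_mono diff_mono mult_left_mono divide_right_mono) auto
    also have "\<dots> = real d / 2 * (ln K + (1 - 1 / K))"
      using M_pos L_pos d_pos by (simp add: K_def field_simps power2_eq_square)
    \<comment> \<open>The bound 1 - 1 / K \<le> ln K lets the estimate vanish as K tends to 1, so no
      additive multiple of d remains.\<close>
    also have "\<dots> \<le> real d / 2 * (ln K + ln K)"
    proof -
      have "ln (1 / K) \<le> 1 / K - 1" using K by (intro ln_le_minus_one) simp
      then have "1 - 1 / K \<le> ln K" using K by (simp add: ln_div)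
      then show ?thesis by (intro mult_left_mono add_mono) auto
    qed
    finally have "(\<integral>x. \<psi> x \<partial>\<mu>) + 1 \<le> l / 4" by (simp add: l_def)
    then have "((\<integral>x. \<psi> x \<partial>\<mu>) + 1) / l \<le> 1 / 4" using l by (simp add: field_simps)
    moreover have "(\<integral>x. 1 / 4 + (\<psi> x + 1 / ratio s x) / l \<partial>\<mu>) = 1 / 4 + ((\<integral>x. \<psi> x \<partial>\<mu>) + 1) / l"
      using int_\<psi> expectation_inverse_ratio[OF s_pos] by (simp add: prob_space)
    ultimately show "(\<integral>x. 1 / 4 + (\<psi> x + 1 / ratio s x) / l \<partial>\<mu>) \<le> 1 / 2" by linarith
  qed
qed

text \<open>By Markov's inequality, points with |x|^2 > 2 M / \<epsilon> cost at most \<epsilon> /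
  2. On the remaining ball the choice of \<open>s\<close> keeps the exponent in
  \<open>ratio_le\<close> at most d, so the ratio is at most \<epsilon> N / 2. One pointwise bound
  covers both cases.\<close>

lemma ratio_bound_fine:
  assumes "0 < \<epsilon>" and s: "s = sqrt (M / (real d * \<epsilon>))"
    and N: "2 / \<epsilon> * (sqrt (L * M / (real d * \<epsilon>)) * exp 1) ^ d \<le> N"
  shows "(\<integral>\<^sup>+x. ennreal (ratio s x / (N + ratio s x)) \<partial>\<mu>) \<le> ennreal \<epsilon>"
proof (rule nn_integral_le_of_integral)
  let ?T = "(sqrt (L * M / (real d * \<epsilon>)) * exp 1) ^ d"
  have s_pos: "0 < s" using M_pos d_pos assms by (simp add: s)
  have s2: "s\<^sup>2 = M / (real d * \<epsilon>)" using M_pos d_pos assms by (simp add: s)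
  have T: "0 < ?T" using L_pos M_pos d_pos assms by simp
  have N_pos: "0 < N"
    using less_le_trans[OF _ N, of 0] T \<open>0 < \<epsilon>\<close> by (simp del: zero_less_power_eq)
  fix x
  have ratio: "0 < ratio s x" by (rule ratio_pos[OF s_pos])
  show "0 \<le> ratio s x / (N + ratio s x)" using ratio N_pos by simp
  show "ratio s x / (N + ratio s x) \<le> \<epsilon> / 2 + \<epsilon> / (2 * M) * sqnorm x"
  proof (cases "sqnorm x \<le> 2 * M / \<epsilon>")
    case True
    have "s * sqrt L = sqrt (L * M / (real d * \<epsilon>))" by (simp add: s mult.commute flip: real_sqrt_mult)
    moreover have "sqnorm x / (2 * s\<^sup>2) - sqnorm (g' x) / (2 * L) \<le> real d"
    proof -
      have "sqnorm x / (2 * s\<^sup>2) \<le> (2 * M / \<epsilon>) / (2 * s\<^sup>2)"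
        using True by (intro divide_right_mono) auto
      also have "\<dots> = real d" using M_pos d_pos assms by (simp add: s2)
      finally show ?thesis using L_pos sqnorm_nonneg[of "g' x"] by (smt (verit) divide_nonneg_nonneg)
    qed
    ultimately have "ratio s x \<le> sqrt (L * M / (real d * \<epsilon>)) ^ d * exp (real d)"
      using ratio_le[OF s_pos, of x] L_pos M_pos assms by (smt (verit) exp_le_cancel_iff mult_left_mono real_sqrt_ge_zero zero_le_power divide_nonneg_nonneg mult_nonneg_nonneg of_nat_0_le_iff)
    also have "\<dots> = ?T" by (simp add: power_mult_distrib exp_of_nat_mult[of d 1, simplified])
    finally have "ratio s x \<le> ?T" .
    moreover have "?T \<le> \<epsilon> / 2 * N"
      using N \<open>0 < \<epsilon>\<close> by (simp add: field_simps)
    ultimately have "ratio s x \<le> \<epsilon> / 2 * N" by linarith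
    then have "ratio s x / N \<le> \<epsilon> / 2" using N_pos by (simp add: field_simps)
    moreover have "ratio s x / (N + ratio s x) \<le> ratio s x / N"
      using N_pos ratio by (intro divide_left_mono) auto
    moreover have "0 \<le> \<epsilon> / (2 * M) * sqnorm x" using M_pos assms by simp
    ultimately show ?thesis by linarith
  next
    case False
    then have "1 \<le> \<epsilon> / (2 * M) * sqnorm x"
      using M_pos assms by (simp add: field_simps)
    moreover have "ratio s x / (N + ratio s x) \<le> 1" using N_pos ratio by simp
    ultimately show ?thesis using assms by linarith
  qed
next
  show "integrable \<mu> (\<lambda>x. \<epsilon> / 2 + \<epsilon> / (2 * M) * sqnorm x)"
    using integrable_sqnorm by simp
  have "(\<integral>x. \<epsilon> / 2 + \<epsilon> / (2 * M) * sqnorm x \<partial>\<mu>) = \<epsilon> / 2 + \<epsilon> / (2 * M) * (\<integral>x. sqnorm x \<partial>\<mu>)"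
    using integrable_sqnorm by (simp add: prob_space)
  also have "\<dots> \<le> \<epsilon> / 2 + \<epsilon> / (2 * M) * M"
    using expectation_sqnorm M_pos assms by (intro add_left_mono mult_left_mono) auto
  finally show "(\<integral>x. \<epsilon> / 2 + \<epsilon> / (2 * M) * sqnorm x \<partial>\<mu>) \<le> \<epsilon>"
    using M_pos by simp
qed

end

section \<open>The sampling algorithm\<close>

text \<open>The query-tree form of \<open>pick\<close>: each round uses \<open>d\<close> seed
  coordinates for the proposal and coordinate \<open>d\<close> for the switch.\<close>

primrec sampler :: "nat \<Rightarrow> real \<Rightarrow> nat \<Rightarrow> point \<Rightarrow> real \<Rightarrow> (nat \<Rightarrow> real) \<Rightarrow> query_tree" where
  "sampler d s 0 x S \<omega> = Output x"
| "sampler d s (Suc n) x S \<omega> =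
    Query (gauss_point d s \<omega>) (\<lambda>a.
      let y = gauss_point d s \<omega>; v = exp (- fst a) / gauss_density d s y
      in sampler d s n (if \<omega> d * (S + v) \<le> v then y else x) (S + v) (\<lambda>i. \<omega> (i + Suc d)))"

lemma length_queries_sampler: "length (queries orc (sampler d s n x S \<omega>)) = n"
  by (induction n arbitrary: x S \<omega>) (auto simp: Let_def)

lemma set_queries_sampler: "set (queries orc (sampler d s n x S \<omega>)) \<subseteq> Rd d"
proof (induction n arbitrary: x S \<omega>)
  case (Suc n)
  then show ?case by (simp only: sampler.simps queries.simps list.set Let_def insert_subset gauss_point_Rd)
qed simp

context smooth_target
begin

text \<open>The weight exp (- f) / q, with q the Gaussian density, omits the unknown factor
  \<open>c\<close>. Its mean under the proposal is therefore 1 / c, and weight divided by mean is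
  \<open>ratio s\<close>.\<close>

lemma sampler_correct:
  assumes s: "0 < s" and "0 < n" "0 \<le> \<epsilon>"
    and le: "(\<integral>\<^sup>+x. ennreal (ratio s x / (real n + ratio s x)) \<partial>\<mu>) \<le> ennreal \<epsilon>"
  defines "sample \<equiv> (\<lambda>\<omega>. result (\<lambda>x. (f x, g x)) (sampler d s n (origin d) 0 \<omega>))"
  shows "sample \<in> measurable random_seed R" "TV \<mu> (distr random_seed R sample) \<le> \<epsilon>"
proof -
  let ?V = "\<lambda>x. exp (- f x) / gauss_density d s x"
  note G = gauss_density_pos[OF s]
  have distr: "distr random_seed R (gauss_point d s) = density R (gauss_density d s)"
    by (rule distr_gauss_point[OF s])
  interpret reservoir R "gauss_point d s" d ?V "1 / c"
  proof
    show "gauss_point d s \<in> measurable random_seed R" by (rule measurable_gauss_point[OF s])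
    show "gauss_point d s (comb_seq d \<omega> \<omega>') = gauss_point d s \<omega>" for \<omega> \<omega>'
      unfolding gauss_point_def by (rule restrict_ext) (simp add: comb_seq_less)
    show "?V \<in> borel_measurable R" by measurable
    show "0 < ?V x" for x using G[of x] by simp
    show "0 < 1 / c" using c_pos by simp
    have "(\<integral>\<^sup>+x. ennreal (?V x) \<partial>distr random_seed R (gauss_point d s)) = (\<integral>\<^sup>+x. ennreal (gauss_density d s x) * ennreal (?V x) \<partial>R)"
      unfolding distr by (rule nn_integral_density) measurable
    also have "\<dots> = (\<integral>\<^sup>+x. ennreal (1 / c) * ennreal (c * exp (- f' x)) \<partial>R)"
    proof (rule nn_integral_cong)
      fix x assume "x \<in> space R"
      then have "f' x = f x" by (simp add: f'_eq)
      with G[of x] c_pos show "ennreal (gauss_density d s x) * ennreal (?V x) = ennreal (1 / c) * ennreal (c * exp (- f' x))"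
        by (simp flip: ennreal_mult)
    qed
    also have "\<dots> = ennreal (1 / c)"
      by (subst nn_integral_cmult) (auto simp: total_mass)
    finally show "(\<integral>\<^sup>+x. ennreal (?V x) \<partial>distr random_seed R (gauss_point d s)) = ennreal (1 / c)" .
  qed
  have "result (\<lambda>x. (f x, g x)) (sampler d s n x S \<omega>) = pick n x S \<omega>" for x S \<omega>
    by (induction n arbitrary: x S \<omega>) (simp_all add: Let_def)
  then have sample: "sample = pick n (origin d) 0"
    by (simp add: sample_def)
  have o: "origin d \<in> space R" by (simp add: origin_def)
  then show "sample \<in> measurable random_seed R"
    unfolding sample by (intro measurable_pick) auto
  have "\<mu> = density Q (\<lambda>x. ennreal (?V x / (1 / c)))"
  proof -
    have "density Q (\<lambda>x. ennreal (?V x / (1 / c))) = density R (\<lambda>x. ennreal (gauss_density d s x) * ennreal (?V x / (1 / c)))"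
      unfolding distr by (rule density_density_eq) measurable
    also have "\<dots> = \<mu>"
      unfolding \<mu>_def
    proof (rule density_cong)
      show "AE x in R. ennreal (gauss_density d s x) * ennreal (?V x / (1 / c)) = ennreal (c * exp (- f x))"
      proof (rule AE_I2)
        fix x
        show "ennreal (gauss_density d s x) * ennreal (?V x / (1 / c)) = ennreal (c * exp (- f x))"
          using G[of x] c_pos by (simp add: mult.commute flip: ennreal_mult)
      qed
    qed measurable
    finally show ?thesis ..
  qed
  moreover have "(\<integral>\<^sup>+x. ennreal (?V x / (real n * (1 / c) + ?V x)) \<partial>\<mu>) \<le> ennreal \<epsilon>"
  proof -
    have "?V x / (real n * (1 / c) + ?V x) = ratio s x / (real n + ratio s x)" if "x \<in> space \<mu>" for x
    proof -
      have "ratio s x = c * ?V x" using that by (simp add: ratio_def f'_eq)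
      moreover have "?V x / (real n * (1 / c) + ?V x) = (c * ?V x) / (c * (real n * (1 / c) + ?V x))"
        using c_pos by simp
      ultimately show ?thesis using c_pos by (simp add: distrib_left)
    qed
    then have "(\<integral>\<^sup>+x. ennreal (?V x / (real n * (1 / c) + ?V x)) \<partial>\<mu>) = (\<integral>\<^sup>+x. ennreal (ratio s x / (real n + ratio s x)) \<partial>\<mu>)"
      by (intro nn_integral_cong) simp
    with le show ?thesis by simp
  qed
  ultimately show "TV \<mu> (distr random_seed R sample) \<le> \<epsilon>"
    unfolding sample by (intro TV_pick_le prob o assms)
qed

end

section \<open>Choice of parameters and query count\<close>

definition proposal_sd :: "nat \<Rightarrow> real \<Rightarrow> real \<Rightarrow> real" where
  "proposal_sd d M \<epsilon> = (if 1 / 2 \<le> \<epsilon> then sqrt (M / real d) else sqrt (M / (real d * \<epsilon>)))"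

text \<open>The least natural numbers allowed by \<open>ratio_bound_coarse\<close> and
  \<open>ratio_bound_fine\<close>; for \<epsilon> \<ge> 1 / 2 the sampler aims at error 1 /
  2.\<close>

definition sample_count :: "nat \<Rightarrow> real \<Rightarrow> real \<Rightarrow> real \<Rightarrow> nat" where
  "sample_count d L M \<epsilon> = (if 1 / 2 \<le> \<epsilon> then nat \<lceil>4 * (exp 4 * (L * M / real d) ^ (4 * d))\<rceil>
    else nat \<lceil>2 / \<epsilon> * (sqrt (L * M / (real d * \<epsilon>)) * exp 1) ^ d\<rceil>)"

lemma sample_count_le:
  assumes "0 < d" "0 < \<epsilon>" "\<epsilon> < 1" "real d \<le> L * M"
  shows "real (sample_count d L M \<epsilon>) \<le> (L * M / (real d * \<epsilon>)) powr (4 * real d) * (400 * (1 / \<epsilon>))"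
proof -
  define K where "K = L * M / real d"
  have K: "1 \<le> K" using assms by (simp add: K_def)
  have "K * \<epsilon> \<le> K * 1" using K assms by (intro mult_left_mono) auto
  then have KB: "K \<le> K / \<epsilon>" using assms by (simp add: pos_le_divide_eq)
  have B1: "1 \<le> K / \<epsilon>" using K KB by linarith
  have B: "L * M / (real d * \<epsilon>) = K / \<epsilon>" by (simp add: K_def)
  have p: "(K / \<epsilon>) powr (4 * real d) = (K / \<epsilon>) ^ (4 * d)"
    using powr_realpow[of "K / \<epsilon>" "4 * d"] B1 by simp
  have P1: "1 \<le> (K / \<epsilon>) ^ (4 * d)" using B1 by (rule one_le_power)
  have e1: "1 \<le> 1 / \<epsilon>" using assms by simp
  have ceil: "real (nat \<lceil>x\<rceil>) \<le> x + 1" if "0 \<le> x" for x :: real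
    using that of_int_ceiling_le_add_one[of x] by (simp add: of_nat_nat)
  show ?thesis
  proof (cases "1 / 2 \<le> \<epsilon>")
    case True
    \<comment> \<open>From e \<le> 3. The total factor 4 * 81 + 1 stays below 400.\<close>
    have e4: "exp 4 \<le> (81 :: real)"
      using power_mono[OF exp_le, of 4] exp_of_nat_mult[of 4 "1 :: real"] by simp
    have "real (sample_count d L M \<epsilon>) \<le> 4 * (exp 4 * K ^ (4 * d)) + 1"
      using True K by (simp add: sample_count_def K_def[symmetric] ceil)
    also have "\<dots> \<le> 4 * (81 * (K / \<epsilon>) ^ (4 * d)) + (K / \<epsilon>) ^ (4 * d)"
      using e4 K KB P1 by (intro add_mono mult_left_mono mult_mono power_mono) auto
    also have "\<dots> \<le> (K / \<epsilon>) ^ (4 * d) * 400" using P1 by simp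
    also have "\<dots> \<le> (K / \<epsilon>) ^ (4 * d) * (400 * (1 / \<epsilon>))"
      using e1 P1 by (intro mult_left_mono) auto
    finally show ?thesis by (simp add: B p)
  next
    case False
    \<comment> \<open>With the base at least 2, its cube exceeds e. This absorbs the factor exp d
      and leads to the exponent 4 d.\<close>
    have B2: "2 \<le> K / \<epsilon>"
      using False K assms by (simp add: pos_le_divide_eq)
    let ?T = "(sqrt (K / \<epsilon>) * exp 1) ^ d"
    have "sqrt (K / \<epsilon>) \<le> K / \<epsilon>"
      using B1 by (intro real_le_lsqrt) (auto simp: self_le_power)
    moreover have "exp 1 \<le> (K / \<epsilon>) ^ 3"
      using power_mono[OF B2, of 3] exp_le by simp
    ultimately have "sqrt (K / \<epsilon>) * exp 1 \<le> K / \<epsilon> * (K / \<epsilon>) ^ 3"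
      using B1 by (intro mult_mono) auto
    also have "\<dots> = (K / \<epsilon>) ^ 4" by (simp add: eval_nat_numeral)
    finally have "?T \<le> ((K / \<epsilon>) ^ 4) ^ d"
      using B1 by (intro power_mono) auto
    then have T: "?T \<le> (K / \<epsilon>) ^ (4 * d)" by (simp only: power_mult)
    have T0: "0 \<le> ?T" using B1 by simp
    have "real (sample_count d L M \<epsilon>) \<le> 2 / \<epsilon> * ?T + 1"
      using False assms T0 by (simp add: sample_count_def B ceil del: zero_le_power_eq)
    also have "\<dots> \<le> 2 / \<epsilon> * (K / \<epsilon>) ^ (4 * d) + 1 / \<epsilon> * (K / \<epsilon>) ^ (4 * d)"
    proof (rule add_mono)
      show "2 / \<epsilon> * ?T \<le> 2 / \<epsilon> * (K / \<epsilon>) ^ (4 * d)" using T assms by (intro mult_left_mono) auto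
      show "1 \<le> 1 / \<epsilon> * (K / \<epsilon>) ^ (4 * d)" using mult_mono[OF e1 P1] assms by simp
    qed
    also have "\<dots> = (K / \<epsilon>) ^ (4 * d) * (3 * (1 / \<epsilon>))" by (simp add: field_simps)
    also have "\<dots> \<le> (K / \<epsilon>) ^ (4 * d) * (400 * (1 / \<epsilon>))"
      using e1 P1 assms by (intro mult_left_mono mult_right_mono) auto
    finally show ?thesis by (simp add: B p)
  qed
qed

context smooth_target
begin

lemma ratio_bound:
  assumes "0 < \<epsilon>" "\<epsilon> < 1"
  shows "0 < proposal_sd d M \<epsilon>" "0 < sample_count d L M \<epsilon>"
    and "(\<integral>\<^sup>+x. ennreal (ratio (proposal_sd d M \<epsilon>) x / (real (sample_count d L M \<epsilon>) + ratio (proposal_sd d M \<epsilon>) x)) \<partial>\<mu>) \<le> ennreal \<epsilon>"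
proof -
  have LM: "0 < L * M / real d" "0 < L * M / (real d * \<epsilon>)" using L_pos M_pos d_pos assms by auto
  show "0 < proposal_sd d M \<epsilon>" using M_pos d_pos assms by (simp add: proposal_sd_def)
  show "0 < sample_count d L M \<epsilon>"
    using LM assms by (auto simp: sample_count_def intro!: mult_pos_pos divide_pos_pos)
  show "(\<integral>\<^sup>+x. ennreal (ratio (proposal_sd d M \<epsilon>) x / (real (sample_count d L M \<epsilon>) + ratio (proposal_sd d M \<epsilon>) x)) \<partial>\<mu>) \<le> ennreal \<epsilon>"
  proof (cases "1 / 2 \<le> \<epsilon>")
    case True
    then have "ennreal (1 / 2) \<le> ennreal \<epsilon>" by (rule ennreal_leI)
    moreover have "4 * (exp 4 * (L * M / real d) ^ (4 * d)) \<le> real (sample_count d L M \<epsilon>)"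
      using True by (simp add: sample_count_def real_nat_ceiling_ge)
    ultimately show ?thesis
      using ratio_bound_coarse[of "proposal_sd d M \<epsilon>" "real (sample_count d L M \<epsilon>)"] True
      by (auto simp: proposal_sd_def)
  next
    case False
    then have "2 / \<epsilon> * (sqrt (L * M / (real d * \<epsilon>)) * exp 1) ^ d \<le> real (sample_count d L M \<epsilon>)"
      by (simp add: sample_count_def real_nat_ceiling_ge)
    then show ?thesis
      using False assms by (intro ratio_bound_fine) (auto simp: proposal_sd_def)
  qed
qed

end

text \<open>The Lipschitz condition between two distinct points, the origin and the all-ones vector,
  forces the sign of \<open>L\<close>.\<close>

lemma lipschitz_Rd_nonneg:
  assumes "0 < d" "lipschitz_Rd d L g"
  shows "0 \<le> L"
proof -
  let ?x = "\<lambda>i\<in>{..<d}. 1 :: real"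
  have "origin d \<in> Rd d" "?x \<in> Rd d" by (auto simp: origin_def)
  then have "nrm d (vdiff d (g ?x) (g (origin d))) \<le> L * nrm d (vdiff d ?x (origin d))"
    using assms(2) by (auto simp: lipschitz_Rd_def)
  moreover have "nrm d (vdiff d ?x (origin d)) = sqrt (real d)"
    by (simp add: nrm_def vdiff_def origin_def L2_set_def)
  ultimately have "0 \<le> L * sqrt (real d)"
    using order.trans[OF L2_set_nonneg] by (simp add: nrm_def)
  then show ?thesis using assms(1) by (simp add: zero_le_mult_iff)
qed

theorem theorem1p2:
  shows "\<exists>(C :: real) (p :: real \<times> real \<times> real \<times> real \<Rightarrow> real)
          (alg :: nat \<Rightarrow> real \<Rightarrow> real \<Rightarrow> real \<Rightarrow> (nat \<Rightarrow> real) \<Rightarrow> query_tree).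
    real_polynomial_function p \<and>
    (\<forall>(d :: nat) (L :: real) (M :: real) (\<epsilon> :: real) (\<mu> :: point measure)
        (f :: point \<Rightarrow> real) (g :: point \<Rightarrow> point).
      3 \<le> d \<longrightarrow> 0 < \<epsilon> \<longrightarrow> \<epsilon> < 1 \<longrightarrow>
      prob_space \<mu> \<longrightarrow>
      has_density_prop_exp_neg d \<mu> f \<longrightarrow>
      C1_with_gradient d f g \<longrightarrow>
      g (origin d) = origin d \<longrightarrow>
      lipschitz_Rd d L g \<longrightarrow>
      integrable \<mu> (\<lambda>x. (nrm d x)\<^sup>2) \<longrightarrow>
      (\<integral>x. (nrm d x)\<^sup>2 \<partial>\<mu>) \<le> M \<longrightarrow>
      (let oracl = (\<lambda>x. (f x, g x));
           sample = (\<lambda>\<omega>. result oracl (alg d L M \<epsilon> \<omega>))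
       in sample \<in> measurable random_seed (lebesgue_Rd d) \<and>
          TV \<mu> (distr random_seed (lebesgue_Rd d) sample) \<le> \<epsilon> \<and>
          (\<forall>\<omega>\<in>space random_seed.
             set (queries oracl (alg d L M \<epsilon> \<omega>)) \<subseteq> Rd d \<and>
             real (length (queries oracl (alg d L M \<epsilon> \<omega>)))
               \<le> (L * M / (real d * \<epsilon>)) powr (C * real d) * p (1 / \<epsilon>, real d, L, M))))"
\<comment> \<open>The exponent 4 d and the factor 400 / \<epsilon> are those of
  \<open>sample_count_le\<close>. The run starts at the origin with weight 0.\<close>
proof (intro exI[of _ 4] exI[of _ "\<lambda>v. 400 * fst v"]
    exI[of _ "\<lambda>d L M \<epsilon>. sampler d (proposal_sd d M \<epsilon>) (sample_count d L M \<epsilon>) (origin d) 0"] conjI allI impI)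
  show "real_polynomial_function (\<lambda>v :: real \<times> real \<times> real \<times> real. 400 * fst v)"
    by (intro real_polynomial_function.intros bounded_linear_fst)
  fix d :: nat and L M \<epsilon> :: real and \<mu> :: "point measure" and f :: "point \<Rightarrow> real" and g :: "point \<Rightarrow> point"
  assume d: "3 \<le> d" and \<epsilon>: "0 < \<epsilon>" "\<epsilon> < 1" and dens: "has_density_prop_exp_neg d \<mu> f"
    and Lip: "lipschitz_Rd d L g"
    and asms: "prob_space \<mu>" "C1_with_gradient d f g" "g (origin d) = origin d"
      "integrable \<mu> (\<lambda>x. (nrm d x)\<^sup>2)" "(\<integral>x. (nrm d x)\<^sup>2 \<partial>\<mu>) \<le> M"
  from dens obtain c where c: "0 < c" "\<mu> = density (lebesgue_Rd d) (\<lambda>x. ennreal (c * exp (- f x)))"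
    unfolding has_density_prop_exp_neg_def by blast
  have d0: "0 < d" using d by simp
  interpret smooth_target d L f g \<mu> c M
    by (intro smooth_target.intro smooth_Rd.intro smooth_target_axioms.intro
        lipschitz_Rd_nonneg[OF d0 Lip] d0 c Lip asms)
  note rb = ratio_bound[OF \<epsilon>]
  show "let oracl = \<lambda>x. (f x, g x);
           sample = (\<lambda>\<omega>. result oracl (sampler d (proposal_sd d M \<epsilon>) (sample_count d L M \<epsilon>) (origin d) 0 \<omega>))
       in sample \<in> measurable random_seed (lebesgue_Rd d) \<and>
          TV \<mu> (distr random_seed (lebesgue_Rd d) sample) \<le> \<epsilon> \<and>
          (\<forall>\<omega>\<in>space random_seed.
             set (queries oracl (sampler d (proposal_sd d M \<epsilon>) (sample_count d L M \<epsilon>) (origin d) 0 \<omega>)) \<subseteq> Rd d \<and>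
             real (length (queries oracl (sampler d (proposal_sd d M \<epsilon>) (sample_count d L M \<epsilon>) (origin d) 0 \<omega>)))
               \<le> (L * M / (real d * \<epsilon>)) powr (4 * real d) * (400 * fst (1 / \<epsilon>, real d, L, M)))"
    unfolding Let_def length_queries_sampler fst_conv
    using sampler_correct[OF rb(1,2) less_imp_le[OF \<epsilon>(1)] rb(3)]
      sample_count_le[OF d_pos \<epsilon> condition_number] set_queries_sampler by blast
qed

end
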